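(* Let $\mathfrak{B}\subseteq[0,1]$ be a fractal microstructure with $\sigma$-finite development $\{\mathfrak{B}_n : n\ge 0\}$, let $F\in L^2(0,1)$, let $f\in\ell^1(\mathfrak{B})$, and let $\beta:\mathfrak{B}\to[0,\infty)$ be a storage coefficient that scales consistently with $\{\mathfrak{B}_n\}$. The following problems are well-posed. (1) For each $n\in\mathbb{N}$: find $p_n\in V$ such that $$\int_0^1 p_n'\,q' + \sum_{b\in\mathfrak{B}_n}\beta(b)\,p_n(b)\,q(b)=\int_0^1 F\,q+\sum_{b\in\mathfrak{B}_n}f(b)\,q(b)\qquad\text{for all } q\in V .$$ (2) Find $p\in V$ such that $$\int_0^1 p'\,q' + \sum_{b\in\mathfrak{B}}\beta(b)\,p(b)\,q(b)=\int_0^1 F\,q+\sum_{b\in\mathfrak{B}}f(b)\,q(b)\qquad\text{for all } q\in V .$$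
   Context: Fractal microstructure: a countable set $\mathfrak{B}\subseteq[0,1]$ for which there exist a sequence of finite subsets $\{\mathfrak{B}_n:n\ge 0\}$ and finitely many similarities $S_1,\dots,S_L:[0,1]\to[0,1]$, $L\ge 2$ (each satisfying $|S_i(x)-S_i(y)|=c_i|x-y|$ for all $x,y$, with $c_i\in[0,1)$), such that $\mathfrak{B}_n=\bigcup_{i=1}^L S_i(\mathfrak{B}_{n-1})$ for all $n\ge1$, and $\mathfrak{B}_n$ is monotonically increasing in $n$ with $\bigcup_n\mathfrak{B}_n=\mathfrak{B}$. Such a sequence $\{\mathfrak{B}_n\}$ is called a $\sigma$-finite development of $\mathfrak{B}$. A storage coefficient $\beta$ on $\mathfrak{B}$ scales consistently with the $\sigma$-finite development $\{\mathfrak{B}_n\}$ (with $L$ similarities) if $$\beta(b)=a\sum_{n\in\mathbb{N}}\Big(\frac1L-\epsilon\Big)^n\mathbf{1}_{\mathfrak{B}_n-\mathfrak{B}_{n-1}}(b)\qquad\text{for } b\in\mathfrak{B},$$ for some $a>0$ and $0<\epsilon<\frac1L$. Here $\mathbb{N}=\{1,2,\dots\}$, $\mathbf{1}_A$ is the indicator function of $A$, and $\mathfrak{B}_n-\mathfrak{B}_{n-1}$ is the set difference. $\ell^1(\mathfrak{B})=\{g:\mathfrak{B}\to\mathbb{R}:\sum_{b\in\mathfrak{B}}|g(b)|<\infty\}$. $V=\{u\in H^1(0,1): u(0)=0\}$ with inner product $\langle u,v\rangle_V=\int_0^1 u'v'$ and the induced norm; $u'$ is the weak derivative, and elements of $H^1(0,1)$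 are identified with their continuous representatives on $[0,1]$. Well-posed (Hadamard sense): for all data $F\in L^2(0,1)$, $f\in\ell^1(\mathfrak{B})$ there is exactly one solution, and it depends continuously on the data. *)

theory Defs
  imports "HOL-Analysis.Analysis"
begin

section \<open>Fractal microstructures\<close>

definition similarity_on_unit :: "(real \<Rightarrow> real) \<Rightarrow> bool" where
  "similarity_on_unit S \<longleftrightarrow>
     S ` {0..1} \<subseteq> {0..1} \<and>
     (\<exists>c. 0 \<le> c \<and> c < 1 \<and> (\<forall>x\<in>{0..1}. \<forall>y\<in>{0..1}. \<bar>S x - S y\<bar> = c * \<bar>x - y\<bar>))"

text \<open>The number \<open>L\<close> of similarities is a parameter, since the scaling condition on storage
  coefficients below refers to it.\<close>

definition sigma_finite_development :: "nat \<Rightarrow> (nat \<Rightarrow> real set) \<Rightarrow> real set \<Rightarrow> bool" where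
  "sigma_finite_development L Bn B \<longleftrightarrow>
     L \<ge> 2 \<and>
     (\<forall>n. finite (Bn n) \<and> Bn n \<subseteq> B) \<and>
     (\<exists>S :: nat \<Rightarrow> real \<Rightarrow> real.
        (\<forall>i\<in>{1..L}. similarity_on_unit (S i)) \<and>
        (\<forall>n\<ge>1. Bn n = (\<Union>i\<in>{1..L}. S i ` Bn (n - 1)))) \<and>
     mono Bn \<and>
     (\<Union>n. Bn n) = B"

definition fractal_microstructure :: "real set \<Rightarrow> bool" where
  "fractal_microstructure B \<longleftrightarrow>
     countable B \<and> B \<subseteq> {0..1} \<and> (\<exists>L Bn. sigma_finite_development L Bn B)"

text \<open>For each \<open>b\<close> at most one term of the series is nonzero, because \<open>Bn\<close> is increasing.\<close>

definition scales_consistently ::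
    "nat \<Rightarrow> (nat \<Rightarrow> real set) \<Rightarrow> real set \<Rightarrow> (real \<Rightarrow> real) \<Rightarrow> bool" where
  "scales_consistently L Bn B \<beta> \<longleftrightarrow>
     (\<exists>a \<epsilon>. a > 0 \<and> 0 < \<epsilon> \<and> \<epsilon> < 1 / real L \<and>
        (\<forall>b\<in>B. \<beta> b =
           a * (\<Sum>\<^sub>\<infinity>n\<in>{1..}. (1 / real L - \<epsilon>) ^ n * indicator (Bn n - Bn (n - 1)) b)))"

section \<open>Function spaces\<close>

text \<open>A function on \<open>B\<close> is represented by a function on the reals of which only the values on
  \<open>B\<close> matter.\<close>

definition ell1 :: "real set \<Rightarrow> (real \<Rightarrow> real) set" where
  "ell1 B = {g. (\<lambda>b. \<bar>g b\<bar>) summable_on B}"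

definition ell1_norm :: "real set \<Rightarrow> (real \<Rightarrow> real) \<Rightarrow> real" where
  "ell1_norm B g = (\<Sum>\<^sub>\<infinity>b\<in>B. \<bar>g b\<bar>)"

abbreviation unit_interval_measure :: "real measure" where
  "unit_interval_measure \<equiv> lebesgue_on {0<..<1}"

text \<open>\<open>L2\<close> consists of functions rather than classes modulo null sets, so \<open>L2_norm\<close> is a
  seminorm on it.\<close>

definition L2 :: "(real \<Rightarrow> real) set" where
  "L2 = {F. F \<in> borel_measurable unit_interval_measure \<and>
            integrable unit_interval_measure (\<lambda>x. (F x)\<^sup>2)}"

definition L2_norm :: "(real \<Rightarrow> real) \<Rightarrow> real" where
  "L2_norm F = sqrt (LINT x|unit_interval_measure. (F x)\<^sup>2)"

definition test_function :: "(real \<Rightarrow> real) \<Rightarrow> bool" where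
  "test_function \<phi> \<longleftrightarrow>
     (\<forall>k x. (deriv ^^ k) \<phi> differentiable (at x)) \<and>
     compact (closure {x. \<phi> x \<noteq> 0}) \<and> closure {x. \<phi> x \<noteq> 0} \<subseteq> {0<..<1}"

definition has_weak_deriv :: "(real \<Rightarrow> real) \<Rightarrow> (real \<Rightarrow> real) \<Rightarrow> bool" where
  "has_weak_deriv u g \<longleftrightarrow>
     (\<forall>\<phi>. test_function \<phi> \<longrightarrow>
        (LINT x|unit_interval_measure. u x * deriv \<phi> x) =
        - (LINT x|unit_interval_measure. g x * \<phi> x))"

definition H1 :: "(real \<Rightarrow> real) set" where
  "H1 = {u \<in> L2. \<exists>g\<in>L2. has_weak_deriv u g}"

text \<open>Weak derivatives are unique only up to null sets; the choice made here does not affect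
  any of the integrals below.\<close>

definition weak_deriv :: "(real \<Rightarrow> real) \<Rightarrow> real \<Rightarrow> real" where
  "weak_deriv u = (SOME g. g \<in> L2 \<and> has_weak_deriv u g)"

text \<open>An element of \<open>V\<close> is the continuous representative on \<open>[0,1]\<close>. As its values outside
  \<open>[0,1]\<close> carry no meaning, they are fixed to be 0, so that equality in \<open>V\<close> is equality
  of functions.\<close>

definition V :: "(real \<Rightarrow> real) set" where
  "V = {u \<in> H1. continuous_on {0..1} u \<and> u 0 = 0 \<and> (\<forall>x. x \<notin> {0..1} \<longrightarrow> u x = 0)}"

definition V_inner :: "(real \<Rightarrow> real) \<Rightarrow> (real \<Rightarrow> real) \<Rightarrow> real" where
  "V_inner u v = (LINT x|unit_interval_measure. weak_deriv u x * weak_deriv v x)"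

definition V_norm :: "(real \<Rightarrow> real) \<Rightarrow> real" where
  "V_norm u = sqrt (V_inner u u)"

section \<open>Well-posedness in the sense of Hadamard\<close>

text \<open>\<open>sol F f p\<close> expresses that \<open>p\<close> satisfies the equation with data \<open>F\<close> and \<open>f\<close>. The last
  conjunct is continuity of the solution map from \<open>L2 \<times> ell1 B\<close> to \<open>V\<close>.\<close>

definition well_posed ::
    "real set \<Rightarrow> ((real \<Rightarrow> real) \<Rightarrow> (real \<Rightarrow> real) \<Rightarrow> (real \<Rightarrow> real) \<Rightarrow> bool) \<Rightarrow> bool" where
  "well_posed B sol \<longleftrightarrow>
     (\<forall>F\<in>L2. \<forall>f\<in>ell1 B. \<exists>!p. p \<in> V \<and> sol F f p) \<and>
     (\<forall>F\<in>L2. \<forall>f\<in>ell1 B. \<forall>p\<in>V. sol F f p \<longrightarrow>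
        (\<forall>e>0. \<exists>d>0. \<forall>G\<in>L2. \<forall>g\<in>ell1 B. \<forall>r\<in>V. sol G g r \<longrightarrow>
           L2_norm (\<lambda>x. G x - F x) + ell1_norm B (\<lambda>b. g b - f b) < d \<longrightarrow>
           V_norm (\<lambda>x. r x - p x) < e))"

end

theory Submission
  imports Defs "HOL-Computational_Algebra.Polynomial"
begin

text \<open>Both problems ask for a function \<open>p\<close> of \<open>V\<close> that satisfies the same equation, with the weights \<open>\<beta>\<close>
  and the point loads \<open>f\<close> living on a countable set \<open>C\<close>: a stage \<open>Bn n\<close> of the development, or its union
  \<open>B\<close>. What makes the infinite case as good as the finite one is that \<open>\<beta>\<close> is summable
  (\<open>storage_coefficient_ell1\<close>): the factor \<open>(1/L - \<epsilon>)\<^sup>n\<close> outweighs the at most \<open>L\<^sup>n card (Bn 0)\<close> points of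
  stage \<open>n\<close>. So well-posedness is shown for every summable weight \<open>\<beta> \<ge> 0\<close> on a countable
  \<open>C \<subseteq> [0,1]\<close>.

  Testing the equation with its solution gives the energy estimate: the norm of \<open>p\<close> is at most the sum of the
  norms of \<open>F\<close> and \<open>f\<close>, whatever the nonnegative weight is (\<open>energy_estimate\<close>). It uses that point
  values on \<open>V\<close> are bounded by the norm. Applied to differences of solutions, it yields
  uniqueness and continuous dependence on the data.

  Existence could be read off from the Riesz representation theorem. Here it is proved by the method of continuity instead, which
  needs only completeness of the bounded continuous functions. For \<open>\<beta> = 0\<close> Fubini's theorem gives the
  derivative of the solution explicitly as a tail of the data (\<open>solvable_zero_weight\<close>). If the problem is
  solvable for \<open>\<beta>\<close>, and \<open>\<gamma>\<close> has \<open>ell1_norm\<close> less than 1, then the Banach fixed point theorem solves it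
  for \<open>\<beta> + \<gamma>\<close> (\<open>solvable_add_small_weight\<close>). As the energy estimate is uniform in the weight, finitely many
  equal steps reach any summable \<open>\<beta> \<ge> 0\<close>.

  All of this rests on the description of \<open>V\<close> as the set of primitives of square-integrable
  functions. One inclusion is integration by parts; the other is the lemma of
  du Bois-Reymond, for which suitable test functions are built from \<open>e\<^bsup>-1/x\<^esup>\<close>.\<close>

section \<open>Square-integrable functions\<close>

lemma finite_unit_interval_measure: "finite_measure unit_interval_measure"
  by (rule finite_measure_lebesgue_on) simp

lemma sigma_finite_unit_interval_measure: "sigma_finite_measure unit_interval_measure"
  using finite_unit_interval_measure by (simp add: finite_measure_def)

text \<open>The bound \<open>\<bar>a b\<bar> \<le> a\<^sup>2 + b\<^sup>2\<close> makes products of square-integrable functions integrable.\<close>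

lemma integrable_square_mult:
  fixes f g :: "'a \<Rightarrow> real"
  assumes [measurable]: "f \<in> borel_measurable M" "g \<in> borel_measurable M"
    and f: "integrable M (\<lambda>x. (f x)\<^sup>2)" and g: "integrable M (\<lambda>x. (g x)\<^sup>2)"
  shows "integrable M (\<lambda>x. f x * g x)"
proof (rule Bochner_Integration.integrable_bound)
  show "integrable M (\<lambda>x. (f x)\<^sup>2 + (g x)\<^sup>2)" using f g by simp
  have "\<bar>a * b\<bar> \<le> a\<^sup>2 + b\<^sup>2" for a b :: real
  proof -
    have "2 * (\<bar>a\<bar> * \<bar>b\<bar>) \<le> a\<^sup>2 + b\<^sup>2" "0 \<le> \<bar>a\<bar> * \<bar>b\<bar>"
      using sum_squares_bound[of "\<bar>a\<bar>" "\<bar>b\<bar>"] by simp_all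
    then show ?thesis by (simp only: abs_mult)
  qed
  then show "AE x in M. norm (f x * g x) \<le> norm ((f x)\<^sup>2 + (g x)\<^sup>2)" by simp
qed simp

lemma L2_borel_measurable: "f \<in> L2 \<Longrightarrow> f \<in> borel_measurable unit_interval_measure"
  by (simp add: L2_def)

lemma L2_integrable_mult:
  assumes "f \<in> L2" "g \<in> L2"
  shows "integrable unit_interval_measure (\<lambda>x. f x * g x)"
  using assms by (auto simp: L2_def intro: integrable_square_mult)

lemma borel_measurable_unit_interval_measure:
  "f \<in> borel_measurable borel \<Longrightarrow> f \<in> borel_measurable unit_interval_measure"
  by (intro measurable_restrict_space1 measurable_completion) simp

lemma id_measurable_unit_interval: "(\<lambda>s. s) \<in> borel_measurable unit_interval_measure"
  by (rule borel_measurable_unit_interval_measure) simp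

lemma bounded_in_L2:
  assumes "f \<in> borel_measurable unit_interval_measure"
    and "\<And>x. x \<in> {0<..<1} \<Longrightarrow> \<bar>f x\<bar> \<le> c"
  shows "f \<in> L2"
proof -
  interpret finite_measure unit_interval_measure by (rule finite_unit_interval_measure)
  have "integrable unit_interval_measure (\<lambda>x. (f x)\<^sup>2)"
  proof (rule integrable_const_bound)
    show "AE x in unit_interval_measure. norm ((f x)\<^sup>2) \<le> c\<^sup>2"
      using order_trans[OF assms(2) abs_ge_self]
      by (auto intro!: AE_I2 simp: abs_le_square_iff[symmetric])
  qed (use assms(1) in simp)
  then show ?thesis using assms(1) by (simp add: L2_def)
qed

lemma L2_const: "(\<lambda>x. c) \<in> L2"
  by (rule bounded_in_L2[where c = "\<bar>c\<bar>"]) auto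

lemma L2_integrable: "f \<in> L2 \<Longrightarrow> integrable unit_interval_measure f"
  using L2_integrable_mult[of f "\<lambda>x. 1"] L2_const by simp

lemma L2_lincomb:
  assumes "f \<in> L2" "g \<in> L2"
  shows "(\<lambda>x. a * f x + b * g x) \<in> L2"
proof -
  have [measurable]: "f \<in> borel_measurable unit_interval_measure"
      "g \<in> borel_measurable unit_interval_measure"
    using assms by (auto simp: L2_def)
  have "integrable unit_interval_measure
      (\<lambda>x. a\<^sup>2 * (f x * f x) + 2 * a * b * (f x * g x) + b\<^sup>2 * (g x * g x))"
    using assms by (intro Bochner_Integration.integrable_add integrable_mult_right L2_integrable_mult)
  also have "(\<lambda>x. a\<^sup>2 * (f x * f x) + 2 * a * b * (f x * g x) + b\<^sup>2 * (g x * g x))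
      = (\<lambda>x. (a * f x + b * g x)\<^sup>2)"
    by (simp add: fun_eq_iff power2_eq_square algebra_simps)
  finally show ?thesis by (simp add: L2_def)
qed

lemma L2_add: "f \<in> L2 \<Longrightarrow> g \<in> L2 \<Longrightarrow> (\<lambda>x. f x + g x) \<in> L2"
  using L2_lincomb[of f g 1 1] by simp

lemma L2_diff: "f \<in> L2 \<Longrightarrow> g \<in> L2 \<Longrightarrow> (\<lambda>x. f x - g x) \<in> L2"
  using L2_lincomb[of f g 1 "-1"] by simp

lemma L2_norm_nonneg: "L2_norm f \<ge> 0"
  by (simp add: L2_norm_def)

lemma L2_norm_square: "(L2_norm f)\<^sup>2 = (LINT x|unit_interval_measure. f x * f x)"
  by (simp add: L2_norm_def power2_eq_square)

text \<open>The quadratic form \<open>(s, t) \<mapsto> \<integral> (s f + t g)\<^sup>2\<close> is nonnegative, so its discriminant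
  is not positive. Evaluating it at \<open>s = \<integral> g\<^sup>2\<close>, \<open>t = - \<integral> f g\<close> gives the inequality, except
  when \<open>\<integral> g\<^sup>2 = 0\<close>; then the form is affine in \<open>t\<close> for \<open>s = 1\<close>, which forces \<open>\<integral> f g = 0\<close>.\<close>

lemma L2_Cauchy_Schwarz:
  assumes "f \<in> L2" "g \<in> L2"
  shows "\<bar>LINT x|unit_interval_measure. f x * g x\<bar> \<le> L2_norm f * L2_norm g"
proof -
  define a b c where "a = (LINT x|unit_interval_measure. f x * f x)"
    and "b = (LINT x|unit_interval_measure. g x * g x)"
    and "c = (LINT x|unit_interval_measure. f x * g x)"
  have quad: "0 \<le> s\<^sup>2 * a + 2 * s * t * c + t\<^sup>2 * b" for s t
  proof -
    have "0 \<le> (LINT x|unit_interval_measure. (s * f x + t * g x)\<^sup>2)" by simp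
    also have "\<dots> = (LINT x|unit_interval_measure.
        s\<^sup>2 * (f x * f x) + 2 * s * t * (f x * g x) + t\<^sup>2 * (g x * g x))"
      by (rule Bochner_Integration.integral_cong) (auto simp: power2_eq_square algebra_simps)
    also have "\<dots> = s\<^sup>2 * a + 2 * s * t * c + t\<^sup>2 * b"
      using assms by (simp add: L2_integrable_mult a_def b_def c_def)
    finally show ?thesis .
  qed
  have "a \<ge> 0" "b \<ge> 0" by (simp_all add: a_def b_def)
  have "c\<^sup>2 \<le> a * b"
  proof (cases "b = 0")
    case True
    have "c = 0"
    proof (rule ccontr)
      assume "c \<noteq> 0"
      with quad[of 1 "- (a + 1) / (2 * c)"] True show False by (simp add: field_simps)
    qed
    with True show ?thesis by simp
  next
    case False
    have "0 \<le> b * (a * b - c\<^sup>2)"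
      using quad[of b "-c"] by (simp add: power2_eq_square algebra_simps)
    with False \<open>b \<ge> 0\<close> show ?thesis by (simp add: zero_le_mult_iff)
  qed
  also have "a * b = (L2_norm f * L2_norm g)\<^sup>2"
    by (simp add: power_mult_distrib L2_norm_square a_def b_def)
  finally show ?thesis
    by (simp add: c_def abs_le_square_iff[symmetric] L2_norm_nonneg abs_mult)
qed

section \<open>Primitives of square-integrable functions\<close>

text \<open>The value 0 outside \<open>[0,1]\<close> is the normalisation used for elements of \<open>V\<close>.\<close>

definition primitive :: "(real \<Rightarrow> real) \<Rightarrow> real \<Rightarrow> real" where
  "primitive h x = (if x \<in> {0..1} then LINT y|unit_interval_measure. indicator {..<x} y * h y else 0)"

lemma indicator_in_L2: "S \<in> sets borel \<Longrightarrow> indicator S \<in> L2"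
  by (rule bounded_in_L2[where c = 1] borel_measurable_unit_interval_measure)+ (auto simp: indicator_def)

lemma L2_norm_indicator_le:
  assumes "x \<le> y"
  shows "L2_norm (indicator {x..<y}) \<le> sqrt (y - x)"
proof -
  have "(LINT z|unit_interval_measure. (indicator {x..<y} z :: real)\<^sup>2)
      = (LINT z|unit_interval_measure. indicator {x..<y} z)"
    by (rule Bochner_Integration.integral_cong) (auto simp: indicator_def)
  also have "\<dots> = (LINT z|lebesgue. indicator ({0<..<1} \<inter> {x..<y}) z)"
    by (subst integral_restrict_space, simp)
      (rule Bochner_Integration.integral_cong[OF refl], simp add: indicator_inter_arith)
  also have "\<dots> \<le> (LINT z|lebesgue. indicator {x..<y} z)"
  proof (rule integral_mono')
    show "integrable lebesgue (indicator {x..<y} :: real \<Rightarrow> real)"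
      by (rule integrable_real_indicator) (use assms in auto)
  qed (auto simp: indicator_def)
  also have "\<dots> = y - x" using assms by simp
  finally show ?thesis by (simp add: L2_norm_def)
qed

text \<open>The embedding of \<open>V\<close> into the bounded functions: point evaluation is the pairing of the
  derivative with an indicator function of norm at most 1.\<close>

lemma primitive_abs_le:
  assumes "h \<in> L2"
  shows "\<bar>primitive h x\<bar> \<le> L2_norm h"
proof (cases "x \<in> {0..1}")
  case True
  have "L2_norm (indicator {..<x}) = L2_norm (indicator {0..<x})"
    unfolding L2_norm_def by (intro arg_cong[of _ _ sqrt] Bochner_Integration.integral_cong) (auto simp: indicator_def)
  also have "\<dots> \<le> 1"
    using L2_norm_indicator_le[of 0 x] True by (simp add: order_trans[of _ "sqrt x"])
  finally have le1: "L2_norm (indicator {..<x}) \<le> 1" .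
  have "\<bar>primitive h x\<bar> \<le> L2_norm (indicator {..<x}) * L2_norm h"
    using True L2_Cauchy_Schwarz[OF indicator_in_L2[of "{..<x}"] assms] by (simp add: primitive_def)
  also have "\<dots> \<le> 1 * L2_norm h"
    using le1 by (rule mult_right_mono) (rule L2_norm_nonneg)
  finally show ?thesis by simp
qed (use L2_norm_nonneg in \<open>auto simp: primitive_def\<close>)

lemma primitive_diff:
  assumes "h \<in> L2" "0 \<le> x" "x \<le> y" "y \<le> 1"
  shows "primitive h y - primitive h x = (LINT z|unit_interval_measure. indicator {x..<y} z * h z)"
proof -
  have i: "integrable unit_interval_measure (\<lambda>z. indicator {..<w} z * h z)" for w
    using assms by (intro L2_integrable_mult indicator_in_L2) auto
  have "primitive h y - primitive h x
      = (LINT z|unit_interval_measure. indicator {..<y} z * h z - indicator {..<x} z * h z)"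
    using assms i by (simp add: primitive_def)
  also have "\<dots> = (LINT z|unit_interval_measure. indicator {x..<y} z * h z)"
    using assms by (intro Bochner_Integration.integral_cong) (auto simp: indicator_def)
  finally show ?thesis .
qed

lemma primitive_Hoelder:
  assumes "h \<in> L2" "0 \<le> x" "x \<le> y" "y \<le> 1"
  shows "\<bar>primitive h y - primitive h x\<bar> \<le> sqrt (y - x) * L2_norm h"
proof -
  have "\<bar>primitive h y - primitive h x\<bar> \<le> L2_norm (indicator {x..<y}) * L2_norm h"
    unfolding primitive_diff[OF assms] by (intro L2_Cauchy_Schwarz indicator_in_L2 assms) simp
  also have "\<dots> \<le> sqrt (y - x) * L2_norm h"
    by (intro mult_right_mono L2_norm_indicator_le L2_norm_nonneg assms)
  finally show ?thesis .
qed

lemma continuous_on_primitive: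
  assumes "h \<in> L2"
  shows "continuous_on {0..1} (primitive h)"
  unfolding continuous_on_def
proof
  fix x :: real assume x: "x \<in> {0..1}"
  have "((\<lambda>y. primitive h y - primitive h x) \<longlongrightarrow> 0) (at x within {0..1})"
  proof (rule Lim_null_comparison)
    show "\<forall>\<^sub>F y in at x within {0..1}. norm (primitive h y - primitive h x) \<le> sqrt \<bar>y - x\<bar> * L2_norm h"
      unfolding eventually_at
    proof (intro exI[of _ 1] conjI ballI impI)
      fix y :: real assume y: "y \<in> {0..1}"
      show "norm (primitive h y - primitive h x) \<le> sqrt \<bar>y - x\<bar> * L2_norm h"
        using primitive_Hoelder[OF assms, of x y] primitive_Hoelder[OF assms, of y x] x y
        by (cases "x \<le> y") (auto simp: abs_minus_commute)
    qed simp
    have "((\<lambda>y. sqrt \<bar>y - x\<bar> * L2_norm h) \<longlongrightarrow> sqrt \<bar>x - x\<bar> * L2_norm h) (at x within {0..1})"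
      by (intro tendsto_intros)
    then show "((\<lambda>y. sqrt \<bar>y - x\<bar> * L2_norm h) \<longlongrightarrow> 0) (at x within {0..1})" by simp
  qed
  then show "(primitive h \<longlongrightarrow> primitive h x) (at x within {0..1})"
    by (simp add: LIM_zero_iff)
qed

lemma continuous_in_L2:
  assumes "continuous_on {0..1} u"
  shows "u \<in> L2"
proof -
  have "compact (u ` {0..1})" using assms by (intro compact_continuous_image) auto
  then obtain c where "\<And>y. y \<in> u ` {0..1} \<Longrightarrow> \<bar>y\<bar> \<le> c"
    using compact_imp_bounded bounded_iff by (metis real_norm_def)
  then have "\<bar>u x\<bar> \<le> c" if "x \<in> {0<..<1}" for x using that by auto
  moreover have "u \<in> borel_measurable unit_interval_measure"
    by (rule continuous_imp_measurable_on_sets_lebesgue)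
      (auto intro: continuous_on_subset[OF assms])
  ultimately show ?thesis by (intro bounded_in_L2)
qed

lemma primitive_in_L2: "h \<in> L2 \<Longrightarrow> primitive h \<in> L2"
  by (rule continuous_in_L2[OF continuous_on_primitive])

lemma primitive_diff_fun:
  assumes "g \<in> L2" "h \<in> L2"
  shows "primitive (\<lambda>x. g x - h x) = (\<lambda>x. primitive g x - primitive h x)"
proof
  fix x :: real
  have i: "integrable unit_interval_measure (\<lambda>z. indicator {..<x} z * h z)" if "h \<in> L2" for h
    using that by (intro L2_integrable_mult indicator_in_L2) auto
  show "primitive (\<lambda>x. g x - h x) x = primitive g x - primitive h x"
    using assms i by (simp add: primitive_def right_diff_distrib)
qed

lemma primitive_0: "primitive h 0 = 0"
proof -
  have "(LINT y|unit_interval_measure. indicator {..<0::real} y * h y) = (LINT y|unit_interval_measure. 0)"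
    by (rule Bochner_Integration.integral_cong) (auto simp: indicator_def)
  then show ?thesis by (simp add: primitive_def)
qed

text \<open>Both kinds of data of the problem, the density \<open>F\<close> and the point loads \<open>f\<close>, are represented
  in \<open>L2\<close> by this one identity: \<open>N\<close> is Lebesgue measure for the former and counting measure on
  the set of load points for the latter. Reading \<open>h\<close> as the derivative of a function \<open>q\<close> of \<open>V\<close>, it says
  that integrating \<open>q\<close> against the signed measure \<open>c dN\<close> is the \<open>L2\<close> inner product of \<open>q'\<close> with
  the tail function of that measure. With \<open>N\<close> Lebesgue measure and \<open>c = \<phi>'\<close> it is also
  integration by parts.\<close>

lemma Fubini_primitive:
  assumes N: "sigma_finite_measure N" and sp: "space N \<subseteq> {0..1}"
    and id: "(\<lambda>s. s) \<in> borel_measurable N"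
    and c: "integrable N c" and h: "h \<in> L2"
  defines "g \<equiv> \<lambda>y. LINT s|N. indicator {y<..} s * c s"
  shows "g \<in> L2"
    and "(LINT s|N. c s * primitive h s) = (LINT y|unit_interval_measure. g y * h y)"
proof -
  interpret N: sigma_finite_measure N by fact
  interpret P: pair_sigma_finite N unit_interval_measure
    by (intro pair_sigma_finite.intro N sigma_finite_unit_interval_measure)
  interpret Q: sigma_finite_measure unit_interval_measure
    by (rule sigma_finite_unit_interval_measure)
  note [measurable] = id borel_measurable_integrable[OF c] L2_borel_measurable[OF h]
  have id2[measurable]: "(\<lambda>y::real. y) \<in> borel_measurable unit_interval_measure"
    by (rule id_measurable_unit_interval)
  have ind: "(\<lambda>(s, y). indicator {y<..} s :: real) = (\<lambda>(s, y). if y < s then 1 else 0)"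
    by (auto simp: fun_eq_iff indicator_def)
  have indm[measurable]: "(\<lambda>(s, y). indicator {y<..} s :: real) \<in> borel_measurable (N \<Otimes>\<^sub>M unit_interval_measure)"
    unfolding ind by measurable
  have gm: "g \<in> borel_measurable unit_interval_measure"
    unfolding g_def
  proof (rule N.borel_measurable_lebesgue_integral)
    have "(\<lambda>(y, s). (if y < s then 1 else 0) * c s :: real) \<in> borel_measurable (unit_interval_measure \<Otimes>\<^sub>M N)"
      by measurable
    also have "(\<lambda>(y, s). (if y < s then 1 else 0) * c s :: real) = (\<lambda>(y, s). indicator {y<..} s * c s)"
      by (auto simp: fun_eq_iff indicator_def)
    finally show "(\<lambda>(y, s). indicator {y<..} s * c s) \<in> borel_measurable (unit_interval_measure \<Otimes>\<^sub>M N)" .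
  qed
  show "g \<in> L2"
  proof (rule bounded_in_L2[OF gm])
    fix y
    have "\<bar>g y\<bar> \<le> (LINT s|N. \<bar>indicator {y<..} s * c s\<bar>)"
      unfolding g_def by (rule integral_abs_bound)
    also have "\<dots> \<le> (LINT s|N. \<bar>c s\<bar>)"
      using c
      by (intro integral_mono Bochner_Integration.integrable_abs Bochner_Integration.integrable_bound[OF c])
        (auto simp: indicator_def)
    finally show "\<bar>g y\<bar> \<le> (LINT s|N. \<bar>c s\<bar>)" .
  qed
  let ?f = "\<lambda>s y. indicator {y<..} s * c s * h y"
  have "integrable (N \<Otimes>\<^sub>M unit_interval_measure) (\<lambda>(s, y). c s * h y)"
  proof (rule P.Fubini_integrable)
    show "AE s in N. integrable unit_interval_measure (\<lambda>y. case (s, y) of (s, y) \<Rightarrow> c s * h y)"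
      using L2_integrable[OF h] by simp
    show "integrable N (\<lambda>s. LINT y|unit_interval_measure. norm (case (s, y) of (s, y) \<Rightarrow> c s * h y))"
      using c by (simp add: abs_mult)
  qed measurable
  then have "integrable (N \<Otimes>\<^sub>M unit_interval_measure) (\<lambda>(s, y). ?f s y)"
  proof (rule Bochner_Integration.integrable_bound)
    have "(\<lambda>(s, y). (case (s, y) of (s, y) \<Rightarrow> indicator {y<..} s) * (c s * h y))
        \<in> borel_measurable (N \<Otimes>\<^sub>M unit_interval_measure)"
      unfolding split_beta' prod.collapse by (intro borel_measurable_times indm[unfolded split_beta']) measurable
    then show "(\<lambda>(s, y). ?f s y) \<in> borel_measurable (N \<Otimes>\<^sub>M unit_interval_measure)"
      by (simp add: split_beta' mult.assoc)
  qed (auto intro!: AE_I2 simp: indicator_def)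
  note Fub = P.Fubini_integral[OF this]
  have "(LINT s|N. c s * primitive h s) = (LINT s|N. LINT y|unit_interval_measure. ?f s y)"
  proof (rule Bochner_Integration.integral_cong[OF refl])
    fix s assume "s \<in> space N"
    then have "c s * primitive h s = (LINT y|unit_interval_measure. c s * (indicator {..<s} y * h y))"
      using sp by (auto simp: primitive_def)
    also have "\<dots> = (LINT y|unit_interval_measure. ?f s y)"
      by (rule Bochner_Integration.integral_cong) (auto simp: indicator_def)
    finally show "c s * primitive h s = (LINT y|unit_interval_measure. ?f s y)" .
  qed
  also have "\<dots> = (LINT y|unit_interval_measure. g y * h y)"
    unfolding Fub[symmetric] g_def by simp
  finally show "(LINT s|N. c s * primitive h s) = (LINT y|unit_interval_measure. g y * h y)" .
qed

section \<open>Test functions\<close>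

text \<open>The polynomial factor makes the family closed under differentiation.\<close>

definition flat_exp :: "real poly \<Rightarrow> real \<Rightarrow> real" where
  "flat_exp P x = (if x > 0 then poly P (1 / x) * exp (- (1 / x)) else 0)"

lemma tendsto_poly_mult_exp_minus: "((\<lambda>t::real. poly P t * exp (- t)) \<longlongrightarrow> 0) at_top"
proof -
  have "((\<lambda>t::real. \<Sum>i\<le>degree P. coeff P i * (t ^ i / exp t)) \<longlongrightarrow> (\<Sum>i\<le>degree P. coeff P i * 0)) at_top"
    by (intro tendsto_intros tendsto_power_div_exp_0)
  then show ?thesis
    by (simp add: poly_altdef sum_distrib_right exp_minus divide_inverse mult.assoc)
qed

lemma flat_exp_tendsto_0: "(flat_exp P \<longlongrightarrow> 0) (at 0)"
proof -
  have "((\<lambda>x::real. poly P (inverse x) * exp (- inverse x)) \<longlongrightarrow> 0) (at_right 0)"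
    using filterlim_compose[OF tendsto_poly_mult_exp_minus[of P] filterlim_inverse_at_top_right] .
  then have "(flat_exp P \<longlongrightarrow> 0) (at_right 0)"
    by (rule Lim_transform_eventually)
      (auto simp: eventually_at_filter flat_exp_def inverse_eq_divide)
  moreover have "(flat_exp P \<longlongrightarrow> 0) (at_left 0)"
    by (rule Lim_transform_eventually[OF tendsto_const]) (auto simp: eventually_at_filter flat_exp_def)
  ultimately show ?thesis by (simp add: filterlim_at_split)
qed

text \<open>The square of the variable comes from differentiating \<open>1 / x\<close>. At 0 the difference quotient is again of this form, with \<open>P\<close> multiplied by the variable,
  and all such functions tend to 0 at 0.\<close>

lemma DERIV_flat_exp:
  "(flat_exp P has_real_derivative flat_exp ([:0, 0, 1:] * (P - pderiv P)) x) (at x)"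
proof -
  consider "x > 0" | "x < 0" | "x = 0" by linarith
  then show ?thesis
  proof cases
    case 1
    have "((\<lambda>x. poly P (1 / x) * exp (- (1 / x))) has_real_derivative
        flat_exp ([:0, 0, 1:] * (P - pderiv P)) x) (at x)"
      using 1 by (auto intro!: derivative_eq_intros simp: flat_exp_def field_simps power2_eq_square)
    then show ?thesis
      by (rule has_field_derivative_transform_within_open[where S = "{0<..}"])
        (use 1 in \<open>auto simp: flat_exp_def\<close>)
  next
    case 2
    have "((\<lambda>x. 0) has_real_derivative flat_exp ([:0, 0, 1:] * (P - pderiv P)) x) (at x)"
      using 2 by (simp add: flat_exp_def)
    then show ?thesis
      by (rule has_field_derivative_transform_within_open[where S = "{..<0}"])
        (use 2 in \<open>auto simp: flat_exp_def\<close>)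
  next
    case 3
    have "(\<lambda>h. (flat_exp P h - flat_exp P 0) / (h - 0)) = flat_exp ([:0, 1:] * P)"
      by (auto simp: flat_exp_def fun_eq_iff)
    then have "((\<lambda>h. (flat_exp P h - flat_exp P 0) / (h - 0)) \<longlongrightarrow> 0) (at 0)"
      using flat_exp_tendsto_0 by simp
    then show ?thesis using 3 by (simp add: has_field_derivative_iff flat_exp_def)
  qed
qed

text \<open>Each generator vanishes outside \<open>[l, r]\<close>. The class consists of smooth functions because
  it is closed under \<open>deriv\<close>.\<close>

inductive bump_combination :: "(real \<Rightarrow> real) \<Rightarrow> bool" where
  bump: "bump_combination (\<lambda>x. flat_exp P (x - l) * flat_exp Q (r - x))"
| add: "bump_combination f \<Longrightarrow> bump_combination g \<Longrightarrow> bump_combination (\<lambda>x. f x + g x)"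

lemma bump_combination_DERIV:
  assumes "bump_combination f"
  shows "\<exists>f'. bump_combination f' \<and> (\<forall>x. (f has_real_derivative f' x) (at x))"
  using assms
proof induction
  case (bump P l Q r)
  let ?D = "\<lambda>P. [:0, 0, 1:] * (P - pderiv P)"
  have neg: "flat_exp (- P) x = - flat_exp P x" for P x by (simp add: flat_exp_def)
  have "((\<lambda>x. flat_exp P (x - l) * flat_exp Q (r - x)) has_real_derivative
      flat_exp (?D P) (x - l) * flat_exp Q (r - x) + flat_exp P (x - l) * flat_exp (- ?D Q) (r - x)) (at x)" for x
    unfolding neg
    by (rule derivative_eq_intros refl DERIV_chain2[OF DERIV_flat_exp] | simp)+
  then show ?case
    by (intro exI[of _ "\<lambda>x. flat_exp (?D P) (x - l) * flat_exp Q (r - x) + flat_exp P (x - l) * flat_exp (- ?D Q) (r - x)"])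
      (auto intro: bump_combination.intros)
next
  case (add f g)
  then obtain f' g' where "bump_combination f'" "\<forall>x. (f has_real_derivative f' x) (at x)"
      "bump_combination g'" "\<forall>x. (g has_real_derivative g' x) (at x)"
    by blast
  then show ?case
    by (intro exI[of _ "\<lambda>x. f' x + g' x"]) (auto intro: bump_combination.intros DERIV_add)
qed

lemma bump_combination_deriv:
  assumes "bump_combination f"
  shows "bump_combination (deriv f)" "f differentiable (at x)"
proof -
  obtain f' where f': "bump_combination f'" "\<And>x. (f has_real_derivative f' x) (at x)"
    using bump_combination_DERIV[OF assms] by blast
  then have "deriv f = f'" by (auto simp: fun_eq_iff DERIV_imp_deriv)
  with f' show "bump_combination (deriv f)" by simp
  show "f differentiable (at x)"
    using f'(2) by (meson field_differentiable_def field_differentiable_imp_differentiable)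
qed

lemma bump_combination_funpow_deriv: "bump_combination f \<Longrightarrow> bump_combination ((deriv ^^ k) f)"
  by (induction k) (auto intro: bump_combination_deriv)

lemma bump_combination_continuous: "bump_combination f \<Longrightarrow> continuous_on S f"
  by (meson bump_combination_deriv(2) continuous_at_imp_continuous_on differentiable_imp_continuous_within)

lemma antiderivative_exists:
  fixes f :: "real \<Rightarrow> real"
  assumes "continuous_on UNIV f"
  obtains F where "\<And>x. (F has_real_derivative f x) (at x)"
  using einterval_antiderivative[of "-\<infinity>" \<infinity> f] assms
  by (auto simp: continuous_on_eq_continuous_at has_real_derivative_iff_has_vector_derivative)

text \<open>The derivatives of test functions are test functions of mean zero. Such a mean-zero function is
  obtained here as a bump around \<open>a\<close> minus the same bump around \<open>b\<close>: if \<open>E\<close> is a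
  primitive of the bump \<open>\<eta>\<close>, then \<open>\<phi>(x) = E(x - a) - E(x - b)\<close> vanishes far to the left and far
  to the right, because \<open>E\<close> is constant on either side of the support of \<open>\<eta>\<close>.\<close>

lemma test_function_bump_difference:
  assumes "0 < e" "0 < a - e" "a + e < 1" "0 < b - e" "b + e < 1"
  defines "\<eta> \<equiv> \<lambda>x. flat_exp 1 (x + e) * flat_exp 1 (e - x)"
  obtains \<phi> where "test_function \<phi>"
    and "\<And>x. (\<phi> has_real_derivative \<eta> (x - a) - \<eta> (x - b)) (at x)"
proof -
  have "bump_combination \<eta>"
    unfolding \<eta>_def using bump[of 1 "- e" 1 e] by simp
  then obtain E where E: "\<And>x. (E has_real_derivative \<eta> x) (at x)"
    using antiderivative_exists[OF bump_combination_continuous] by metis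
  have zero: "\<eta> x = 0" if "x \<le> - e \<or> e \<le> x" for x
    using that by (auto simp: \<eta>_def flat_exp_def)
  have left: "E x = E (- e)" if "x \<le> - e" for x
  proof (cases "x = - e")
    case False
    then show ?thesis
      by (intro DERIV_isconst_end[symmetric])
        (use that zero E in \<open>auto intro!: DERIV_isCont continuous_at_imp_continuous_on\<close>, metis less_eq_real_def)
  qed simp
  have right: "E x = E e" if "e \<le> x" for x
  proof (cases "x = e")
    case False
    then show ?thesis
      by (intro DERIV_isconst_end)
        (use that zero E in \<open>auto intro!: DERIV_isCont continuous_at_imp_continuous_on\<close>, metis less_eq_real_def)
  qed simp
  define \<phi> where "\<phi> = (\<lambda>x. E (x - a) - E (x - b))"
  have D: "(\<phi> has_real_derivative \<eta> (x - a) - \<eta> (x - b)) (at x)" for x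
    unfolding \<phi>_def by (rule derivative_eq_intros refl DERIV_chain2[OF E] | simp)+
  have "deriv \<phi> = (\<lambda>x. \<eta> (x - a) - \<eta> (x - b))"
    using D by (auto simp: fun_eq_iff DERIV_imp_deriv)
  also have "\<dots> = (\<lambda>x. flat_exp 1 (x - (a - e)) * flat_exp 1 (a + e - x) + flat_exp (-1) (x - (b - e)) * flat_exp 1 (b + e - x))"
    by (auto simp: fun_eq_iff \<eta>_def flat_exp_def algebra_simps)
  finally have bc: "bump_combination (deriv \<phi>)"
    by (simp only:) (intro bump_combination.intros)
  have "(deriv ^^ k) \<phi> differentiable (at x)" for k x
  proof (cases k)
    case 0
    then show ?thesis
      using D by (auto simp: real_differentiable_def)
  next
    case (Suc j)
    then show ?thesis
      using bump_combination_deriv(2)[OF bump_combination_funpow_deriv[OF bc, of j]]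
      by (simp add: funpow_swap1)
  qed
  moreover obtain lo hi where lohi: "lo \<le> a" "lo \<le> b" "a \<le> hi" "b \<le> hi" "0 < lo - e" "hi + e < 1"
  proof
    show "min a b \<le> a" "min a b \<le> b" "a \<le> max a b" "b \<le> max a b" by simp_all
    show "0 < min a b - e" using \<open>0 < a - e\<close> \<open>0 < b - e\<close> by (simp add: min_def)
    show "max a b + e < 1" using \<open>a + e < 1\<close> \<open>b + e < 1\<close> by (simp add: max_def)
  qed
  have "{x. \<phi> x \<noteq> 0} \<subseteq> {lo - e..hi + e}"
  proof
    fix x assume "x \<in> {x. \<phi> x \<noteq> 0}"
    then have nz: "\<phi> x \<noteq> 0" by simp
    show "x \<in> {lo - e..hi + e}"
    proof (rule ccontr)
      assume "x \<notin> {lo - e..hi + e}"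
      then have "x < lo - e \<or> hi + e < x" by auto
      then have "x - a \<le> - e \<and> x - b \<le> - e \<or> e \<le> x - a \<and> e \<le> x - b"
        using lohi by auto
      then have "\<phi> x = 0" 
        using left[of "x - a"] left[of "x - b"] right[of "x - a"] right[of "x - b"]
        by (auto simp: \<phi>_def)
      with nz show False by simp
    qed
  qed
  then have cl: "closure {x. \<phi> x \<noteq> 0} \<subseteq> {lo - e..hi + e}"
    by (rule closure_minimal) simp
  moreover from cl have "compact (closure {x. \<phi> x \<noteq> 0})"
    by (meson bounded_closed_interval bounded_subset closed_closure compact_eq_bounded_closed)
  moreover have "{lo - e..hi + e} \<subseteq> {0<..<1}" using lohi by auto
  ultimately have "test_function \<phi>" unfolding test_function_def by blast
  then show thesis using D that by blast
qed

section \<open>The space V consists of the primitives\<close>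

lemma LINT_unit_interval_eq_integral:
  fixes f :: "real \<Rightarrow> real"
  assumes "integrable unit_interval_measure f"
  shows "(LINT x|unit_interval_measure. f x) = integral {0..1} f"
  using has_integral_integral_lebesgue_on[OF assms]
  by (simp add: has_integral_Icc_iff_Ioo[symmetric] integral_unique)

lemma test_functionD:
  assumes "test_function \<phi>"
  shows "(\<phi> has_real_derivative deriv \<phi> x) (at x)" "continuous_on S (deriv \<phi>)" "continuous_on S \<phi>"
    "x \<notin> {0<..<1} \<Longrightarrow> \<phi> x = 0" "\<phi> \<in> L2" "deriv \<phi> \<in> L2"
proof -
  have d: "(deriv ^^ k) \<phi> differentiable (at x)" for k x using assms by (auto simp: test_function_def)
  show 1: "(\<phi> has_real_derivative deriv \<phi> x) (at x)" for x
    using d[of 0 x] by (auto simp: real_differentiable_def DERIV_imp_deriv)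
  have "deriv \<phi> differentiable (at x)" for x using d[of 1 x] by simp
  then show 2: "continuous_on S (deriv \<phi>)" for S
    by (meson continuous_at_imp_continuous_on differentiable_imp_continuous_within)
  show 3: "continuous_on S \<phi>" for S
    using 1 DERIV_isCont continuous_at_imp_continuous_on by blast
  show "x \<notin> {0<..<1} \<Longrightarrow> \<phi> x = 0"
    using assms closure_subset[of "{x. \<phi> x \<noteq> 0}"] by (auto simp: test_function_def)
  show "\<phi> \<in> L2" "deriv \<phi> \<in> L2" by (intro continuous_in_L2 2 3)+
qed

lemma integral_test_function_tail:
  assumes "test_function \<phi>" "0 < y" "y < 1"
  shows "(LINT s|unit_interval_measure. indicator {y<..} s * deriv \<phi> s) = - \<phi> y"
proof -
  let ?f = "\<lambda>s. indicator {y<..} s * deriv \<phi> s"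
  have "integrable unit_interval_measure ?f"
    by (intro L2_integrable_mult indicator_in_L2 test_functionD assms) simp
  then have "(?f has_integral (LINT s|unit_interval_measure. ?f s)) {0<..<1}"
    by (rule has_integral_integral_lebesgue_on) simp
  moreover have "(?f has_integral - \<phi> y) {0<..<1}"
  proof -
    have "(deriv \<phi> has_integral \<phi> 1 - \<phi> y) {y..1}"
      using assms
      by (intro fundamental_theorem_of_calculus)
        (auto simp flip: has_real_derivative_iff_has_vector_derivative
          intro: has_field_derivative_at_within test_functionD)
    then have "(deriv \<phi> has_integral - \<phi> y) {y<..<1}"
      using test_functionD(4)[OF assms(1), of 1] by (simp add: has_integral_Icc_iff_Ioo)
    then have "((\<lambda>s. if s \<in> {y<..<1} then deriv \<phi> s else 0) has_integral - \<phi> y) {0<..<1}"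
      using assms by (subst has_integral_restrict) auto
    then show ?thesis
      by (rule has_integral_eq[rotated]) (auto simp: indicator_def)
  qed
  ultimately show ?thesis by (rule has_integral_unique)
qed

lemma has_weak_deriv_primitive:
  assumes "h \<in> L2"
  shows "has_weak_deriv (primitive h) h"
  unfolding has_weak_deriv_def
proof (intro allI impI)
  fix \<phi> assume \<phi>: "test_function \<phi>"
  have "(LINT x|unit_interval_measure. primitive h x * deriv \<phi> x)
      = (LINT y|unit_interval_measure. (LINT s|unit_interval_measure. indicator {y<..} s * deriv \<phi> s) * h y)"
    using Fubini_primitive(2)[OF sigma_finite_unit_interval_measure _ id_measurable_unit_interval
        L2_integrable[OF test_functionD(6)[OF \<phi>]] assms]
    by (simp add: mult.commute greaterThanLessThan_subseteq_atLeastAtMost_iff)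
  also have "\<dots> = (LINT y|unit_interval_measure. - (h y * \<phi> y))"
    by (rule Bochner_Integration.integral_cong) (auto simp: integral_test_function_tail[OF \<phi>])
  finally show "(LINT x|unit_interval_measure. primitive h x * deriv \<phi> x)
      = - (LINT x|unit_interval_measure. h x * \<phi> x)" by simp
qed

lemma primitive_in_V: "h \<in> L2 \<Longrightarrow> primitive h \<in> V"
  unfolding V_def H1_def
  using primitive_in_L2 has_weak_deriv_primitive continuous_on_primitive primitive_0
  by (auto simp: primitive_def)

text \<open>Extended by 0, \<open>d\<close> has integral 0 over every small interval to the right of a point of \<open>(0,1)\<close>. By
  Lebesgue differentiation \<open>d\<close> is almost everywhere the limit of its means over
  these intervals.\<close>

lemma AE_eq_0_if_primitive_eq_0:
  assumes d: "d \<in> L2" and zero: "\<And>x. primitive d x = 0"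
  shows "AE x in unit_interval_measure. d x = 0"
proof -
  define f where "f = (\<lambda>y. if y \<in> {0<..<1} then d y else 0)"
  have "integrable lebesgue f"
    unfolding f_def using L2_integrable[OF d] by (subst Lebesgue_Measure.integrable_restrict_UNIV) auto
  then have "f integrable_on UNIV"
    using integrable_on_lebesgue by blast
  then have "f integrable_on cbox a b" for a b
    using integrable_on_subcbox by blast
  then obtain N where N: "negligible N"
    and lim: "\<And>x e. \<lbrakk>x \<notin> N; 0 < e\<rbrakk> \<Longrightarrow> \<exists>\<delta>>0. \<forall>h. 0 < h \<and> h < \<delta> \<longrightarrow>
        norm (integral (cbox x (x + h *\<^sub>R One)) f /\<^sub>R h ^ DIM(real) - f x) < e"
    using integrable_ccontinuous_explicit[of f] by blast
  have int0: "integral {x..x + h} f = 0" if "0 < x" "0 < h" "x + h < 1" for x h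
  proof -
    have "integrable unit_interval_measure (\<lambda>z. indicator {x..<x + h} z * d z)"
      by (intro L2_integrable_mult indicator_in_L2 d) simp
    from has_integral_integral_lebesgue_on[OF this]
    have "((\<lambda>z. indicator {x..<x + h} z * d z) has_integral 0) {0<..<1}"
      using primitive_diff[OF d, of x "x + h"] zero that by simp
    then have "((\<lambda>z. if z \<in> {x..x + h} then f z else 0) has_integral 0) {0<..<1}"
      by (rule has_integral_spike[rotated 2, where S = "{x + h}"]) (auto simp: indicator_def f_def)
    then have "(f has_integral 0) {x..x + h}"
      using that by (subst (asm) has_integral_restrict) auto
    then show ?thesis by (rule integral_unique)
  qed
  have "d x = 0" if x: "x \<in> {0<..<1}" "x \<notin> N" for x
  proof (rule ccontr)
    assume "d x \<noteq> 0"
    then obtain \<delta> where "\<delta> > 0" and \<delta>: "\<And>h. 0 < h \<Longrightarrow> h < \<delta> \<Longrightarrow> norm (integral {x..x + h} f / h - d x) < \<bar>d x\<bar>"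
      using lim[of x "\<bar>d x\<bar>"] x by (auto simp: f_def divide_inverse mult.commute)
    define h where "h = min \<delta> (1 - x) / 2"
    have "0 < h" "h < \<delta>" "x + h < 1"
      using \<open>\<delta> > 0\<close> x by (auto simp: h_def min_def field_simps)
    then show False using \<delta>[of h] int0[of x h] x by simp
  qed
  moreover have "AE x in lebesgue. x \<notin> N"
    using N by (simp add: AE_not_in negligible_iff_null_sets)
  ultimately show ?thesis
    by (subst AE_restrict_space_iff) (auto elim!: eventually_mono)
qed

text \<open>If \<open>w a < m < w b\<close> for some \<open>a\<close>, \<open>b\<close> in \<open>(0,1)\<close>, choose \<open>\<phi>\<close> with \<open>\<phi>'\<close> a narrow bump around \<open>a\<close> minus the same bump around
  \<open>b\<close>. Then \<open>(m - w) \<phi>' \<ge> 0\<close> with strict inequality at \<open>a\<close>, although \<open>\<integral> m \<phi>' = 0\<close> and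
  \<open>\<integral> w \<phi>' = 0\<close>. Hence \<open>w\<close> is constant on the open interval, and on the closed one by
  continuity.\<close>

lemma du_Bois_Reymond:
  assumes w: "continuous_on {0..1} w"
    and orth: "\<And>\<phi>. test_function \<phi> \<Longrightarrow> (LINT x|unit_interval_measure. w x * deriv \<phi> x) = 0"
    and x: "x \<in> {0..1}"
  shows "w x = w 0"
proof -
  have no_increase: False if ab: "a \<in> {0<..<1}" "b \<in> {0<..<1}" "w a < w b" for a b
  proof -
    define m where "m = (w a + w b) / 2"
    have m: "w a < m" "m < w b" using ab by (auto simp: m_def)
    have cont: "isCont w z" if "z \<in> {0<..<1}" for z
      using continuous_on_interior[OF w, of z] that by simp
    have "\<forall>\<^sub>F z in nhds a. w z < m \<and> z \<in> {0<..<1}"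
      using order_tendstoD(2)[OF cont[OF ab(1), unfolded isCont_def tendsto_at_iff_tendsto_nhds] m(1)]
        eventually_nhds_in_open[of "{0<..<1}" a] ab by (auto intro: eventually_conj)
    then obtain ea where ea: "ea > 0" "\<And>z. dist z a < ea \<Longrightarrow> w z < m \<and> z \<in> {0<..<1}"
      unfolding eventually_nhds_metric by blast
    have "\<forall>\<^sub>F z in nhds b. m < w z \<and> z \<in> {0<..<1}"
      using order_tendstoD(1)[OF cont[OF ab(2), unfolded isCont_def tendsto_at_iff_tendsto_nhds] m(2)]
        eventually_nhds_in_open[of "{0<..<1}" b] ab by (auto intro: eventually_conj)
    then obtain eb where eb: "eb > 0" "\<And>z. dist z b < eb \<Longrightarrow> m < w z \<and> z \<in> {0<..<1}"
      unfolding eventually_nhds_metric by blast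
    define e where "e = min ea eb / 2"
    have e: "0 < e" "e < ea" "e < eb" using ea eb by (auto simp: e_def)
    have "a - e \<in> {0<..<1}" "a + e \<in> {0<..<1}" "b - e \<in> {0<..<1}" "b + e \<in> {0<..<1}"
      using e ea(2)[of "a - e"] ea(2)[of "a + e"] eb(2)[of "b - e"] eb(2)[of "b + e"]
      by (auto simp: dist_real_def)
    define \<eta> where "\<eta> = (\<lambda>x. flat_exp 1 (x + e) * flat_exp 1 (e - x))"
    obtain \<phi> where \<phi>: "test_function \<phi>"
      and D: "\<And>x. (\<phi> has_real_derivative \<eta> (x - a) - \<eta> (x - b)) (at x)"
      using test_function_bump_difference[of e a b] e \<open>a - e \<in> _\<close> \<open>a + e \<in> _\<close> \<open>b - e \<in> _\<close> \<open>b + e \<in> _\<close>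
      unfolding \<eta>_def by auto
    have d\<phi>: "deriv \<phi> x = \<eta> (x - a) - \<eta> (x - b)" for x
      using D by (rule DERIV_imp_deriv)
    have \<eta>: "\<eta> z \<ge> 0" "\<bar>z\<bar> \<ge> e \<Longrightarrow> \<eta> z = 0" "\<eta> 0 > 0" for z
      using e by (auto simp: \<eta>_def flat_exp_def)
    let ?f = "\<lambda>x. (m - w x) * deriv \<phi> x"
    have parts: "0 \<le> (m - w x) * \<eta> (x - a)" "0 \<le> (w x - m) * \<eta> (x - b)" for x
    proof -
      show "0 \<le> (m - w x) * \<eta> (x - a)"
        using \<eta>(1,2)[of "x - a"] ea(2)[of x] e by (cases "\<bar>x - a\<bar> \<ge> e") (auto simp: dist_real_def)
      show "0 \<le> (w x - m) * \<eta> (x - b)"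
        using \<eta>(1,2)[of "x - b"] eb(2)[of x] e by (cases "\<bar>x - b\<bar> \<ge> e") (auto simp: dist_real_def)
    qed
    have fsum: "?f x = (m - w x) * \<eta> (x - a) + (w x - m) * \<eta> (x - b)" for x
      by (simp add: d\<phi> algebra_simps)
    have cf: "continuous_on {0..1} ?f"
      by (intro continuous_intros w test_functionD \<phi>)
    have i1: "integrable unit_interval_measure (deriv \<phi>)"
      and i2: "integrable unit_interval_measure (\<lambda>x. w x * deriv \<phi> x)"
      by (intro L2_integrable L2_integrable_mult continuous_in_L2 w test_functionD \<phi>)+
    have "integral {0..1} ?f = (LINT x|unit_interval_measure. ?f x)"
      by (rule LINT_unit_interval_eq_integral[symmetric]) (intro L2_integrable continuous_in_L2 cf)
    also have "\<dots> = m * (LINT x|unit_interval_measure. deriv \<phi> x) - (LINT x|unit_interval_measure. w x * deriv \<phi> x)"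
      using i1 i2 by (simp add: left_diff_distrib)
    also have "(LINT x|unit_interval_measure. deriv \<phi> x) = 0"
    proof -
      have "(deriv \<phi> has_integral \<phi> 1 - \<phi> 0) {0..1}"
        by (intro fundamental_theorem_of_calculus)
          (auto simp flip: has_real_derivative_iff_has_vector_derivative
            intro: has_field_derivative_at_within test_functionD \<phi>)
      then show ?thesis
        using LINT_unit_interval_eq_integral[OF i1] test_functionD(4)[OF \<phi>] by (simp add: integral_unique)
    qed
    finally have "integral {0..1} ?f = 0" using orth[OF \<phi>] by simp
    moreover have "?f x \<ge> 0" for x
      unfolding fsum using parts by (rule add_nonneg_nonneg)
    ultimately have "\<forall>x\<in>{0..1}. ?f x = 0"
      using integral_eq_0_iff[OF cf] by simp
    then have "?f a = 0" using ab by auto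
    moreover have "?f a > 0"
      using fsum[of a] parts(2)[of a] \<eta>(3) m by (simp add: add_pos_nonneg)
    ultimately show False by linarith
  qed
  have const: "w y = w (1/2)" if "y \<in> {0<..<1}" for y
    using no_increase[of y "1/2"] no_increase[of "1/2" y] that by force
  have "w y = w (1/2)" if "y \<in> {0..1}" for y
    by (rule continuous_constant_on_closure[where S = "{0<..<1}", OF _ const]) (use w that in simp_all)
  from this[OF x] this[of 0] show ?thesis by simp
qed

lemma V_eq_primitive:
  assumes u: "u \<in> V" and g: "g \<in> L2" and "has_weak_deriv u g"
  shows "u = primitive g"
proof
  fix x
  have cu: "continuous_on {0..1} u" and "u 0 = 0" using u by (auto simp: V_def)
  show "u x = primitive g x"
  proof (cases "x \<in> {0..1}")
    case True
    have "u x - primitive g x = u 0 - primitive g 0"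
    proof (rule du_Bois_Reymond[OF _ _ True])
      show "continuous_on {0..1} (\<lambda>x. u x - primitive g x)"
        by (intro continuous_intros cu continuous_on_primitive g)
      fix \<phi> assume \<phi>: "test_function \<phi>"
      have i: "integrable unit_interval_measure (\<lambda>x. u x * deriv \<phi> x)"
        "integrable unit_interval_measure (\<lambda>x. primitive g x * deriv \<phi> x)"
        by (intro L2_integrable_mult continuous_in_L2[OF cu] primitive_in_L2 g test_functionD \<phi>)+
      have "(LINT x|unit_interval_measure. u x * deriv \<phi> x) = (LINT x|unit_interval_measure. primitive g x * deriv \<phi> x)"
        using assms(3) has_weak_deriv_primitive[OF g] \<phi> by (simp add: has_weak_deriv_def)
      then show "(LINT x|unit_interval_measure. (u x - primitive g x) * deriv \<phi> x) = 0"
        using i by (simp add: left_diff_distrib)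
    qed
    then show ?thesis using \<open>u 0 = 0\<close> primitive_0 by simp
  qed (use u in \<open>auto simp: V_def primitive_def\<close>)
qed

lemma weak_deriv_V:
  assumes "u \<in> V"
  shows "weak_deriv u \<in> L2" "primitive (weak_deriv u) = u"
proof -
  have "\<exists>g. g \<in> L2 \<and> has_weak_deriv u g" using assms by (auto simp: V_def H1_def)
  from someI_ex[OF this] have "weak_deriv u \<in> L2 \<and> has_weak_deriv u (weak_deriv u)"
    by (simp add: weak_deriv_def)
  then show "weak_deriv u \<in> L2" "primitive (weak_deriv u) = u"
    using V_eq_primitive[OF assms] by auto
qed

text \<open>As \<open>weak_deriv\<close> is an arbitrary choice among the weak derivatives, it can be computed only
  up to null sets: two choices have the same primitive, so their difference has primitive 0.\<close>

lemma weak_deriv_primitive: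
  assumes "h \<in> L2"
  shows "AE x in unit_interval_measure. weak_deriv (primitive h) x = h x"
proof -
  note wd = weak_deriv_V[OF primitive_in_V[OF assms]]
  have "AE x in unit_interval_measure. weak_deriv (primitive h) x - h x = 0"
    by (rule AE_eq_0_if_primitive_eq_0)
      (use wd assms in \<open>simp_all add: L2_diff primitive_diff_fun\<close>)
  then show ?thesis by simp
qed

section \<open>Summable families\<close>

lemma ell1_mult_bounded:
  assumes c: "c \<in> ell1 C" and K: "\<And>b. b \<in> C \<Longrightarrow> \<bar>u b\<bar> \<le> K"
  shows "(\<lambda>b. c b * u b) \<in> ell1 C" "ell1_norm C (\<lambda>b. c b * u b) \<le> K * ell1_norm C c"
proof -
  have sc: "(\<lambda>b. K * \<bar>c b\<bar>) summable_on C"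
    using c by (intro summable_on_cmult_right) (simp add: ell1_def)
  have le: "\<bar>c b * u b\<bar> \<le> K * \<bar>c b\<bar>" if "b \<in> C" for b
    using mult_right_mono[OF K[OF that], of "\<bar>c b\<bar>"] by (simp add: abs_mult mult.commute)
  show 1: "(\<lambda>b. c b * u b) \<in> ell1 C"
    unfolding ell1_def using le by (auto intro: summable_on_comparison_test[OF sc])
  have "ell1_norm C (\<lambda>b. c b * u b) \<le> (\<Sum>\<^sub>\<infinity>b\<in>C. K * \<bar>c b\<bar>)"
    unfolding ell1_norm_def using 1 le by (intro infsum_mono sc) (auto simp: ell1_def)
  also have "\<dots> = K * ell1_norm C c"
    using c by (simp add: ell1_norm_def ell1_def infsum_cmult_right)
  finally show "ell1_norm C (\<lambda>b. c b * u b) \<le> K * ell1_norm C c" .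
qed

lemma ell1_summable: "c \<in> ell1 C \<Longrightarrow> c summable_on C"
  unfolding ell1_def using abs_summable_summable[of c C] by simp

lemma infsum_le_ell1_norm: "c \<in> ell1 C \<Longrightarrow> \<bar>\<Sum>\<^sub>\<infinity>b\<in>C. c b\<bar> \<le> ell1_norm C c"
  unfolding ell1_def ell1_norm_def using norm_infsum_bound[of c C] by simp

lemma ell1_norm_nonneg: "ell1_norm C c \<ge> 0"
  unfolding ell1_norm_def by (rule infsum_nonneg) simp

lemma ell1_add: "c \<in> ell1 C \<Longrightarrow> d \<in> ell1 C \<Longrightarrow> (\<lambda>b. c b + d b) \<in> ell1 C"
  unfolding ell1_def
  by (auto intro!: summable_on_comparison_test[of "\<lambda>b. \<bar>c b\<bar> + \<bar>d b\<bar>"] summable_on_add)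

lemma ell1_infsum_diff:
  assumes "c \<in> ell1 C" "d \<in> ell1 C"
  shows "(\<Sum>\<^sub>\<infinity>b\<in>C. c b - d b) = (\<Sum>\<^sub>\<infinity>b\<in>C. c b) - (\<Sum>\<^sub>\<infinity>b\<in>C. d b)"
  using infsum_add[of c C "\<lambda>b. - d b"] assms by (simp add: ell1_summable summable_on_uminus infsum_uminus)

lemma ell1_diff: "c \<in> ell1 C \<Longrightarrow> d \<in> ell1 C \<Longrightarrow> (\<lambda>b. c b - d b) \<in> ell1 C"
  using ell1_add[of c C "\<lambda>b. - d b"] by (simp add: ell1_def)

lemma ell1_scale: "c \<in> ell1 C \<Longrightarrow> (\<lambda>b. t * c b) \<in> ell1 C"
  using ell1_mult_bounded(1)[of c C "\<lambda>b. t" "\<bar>t\<bar>"] by (simp add: mult.commute)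

lemma ell1_subset:
  assumes "c \<in> ell1 B" "C \<subseteq> B"
  shows "c \<in> ell1 C" "ell1_norm C c \<le> ell1_norm B c"
proof -
  show 1: "c \<in> ell1 C" using assms summable_on_subset_banach by (auto simp: ell1_def)
  show "ell1_norm C c \<le> ell1_norm B c"
    unfolding ell1_norm_def
    using 1 assms by (intro infsum_mono_neutral) (auto simp: ell1_def)
qed

section \<open>The energy estimate\<close>

lemma V_abs_le: "u \<in> V \<Longrightarrow> \<bar>u x\<bar> \<le> V_norm u"
  using primitive_abs_le[of "weak_deriv u" x] weak_deriv_V[of u]
  by (simp add: V_norm_def V_inner_def L2_norm_def power2_eq_square)

lemma V_norm_square: "(V_norm u)\<^sup>2 = (LINT x|unit_interval_measure. weak_deriv u x * weak_deriv u x)"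
  by (simp add: V_norm_def V_inner_def)

lemma V_norm_nonneg: "V_norm u \<ge> 0"
  by (simp add: V_norm_def V_inner_def)

lemma V_in_L2: "u \<in> V \<Longrightarrow> u \<in> L2"
  by (simp add: V_def H1_def)

lemma L2_norm_le_V_norm:
  assumes "u \<in> V"
  shows "L2_norm u \<le> V_norm u"
proof -
  interpret finite_measure unit_interval_measure by (rule finite_unit_interval_measure)
  have "(LINT x|unit_interval_measure. u x * u x) \<le> (LINT x|unit_interval_measure. (V_norm u)\<^sup>2)"
    using assms
    by (intro integral_mono L2_integrable_mult V_in_L2)
      (auto simp: power2_eq_square[symmetric] abs_le_square_iff[symmetric] intro: order_trans[OF V_abs_le])
  also have "\<dots> = (V_norm u)\<^sup>2" by (simp add: measure_restrict_space)
  finally show ?thesis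
    by (simp add: L2_norm_def power2_eq_square real_le_lsqrt V_norm_nonneg)
qed

lemma weak_deriv_integral_primitive:
  assumes "h \<in> L2" "q \<in> V"
  shows "(LINT x|unit_interval_measure. weak_deriv (primitive h) x * weak_deriv q x)
       = (LINT x|unit_interval_measure. h x * weak_deriv q x)"
proof (rule integral_cong_AE)
  have [measurable]: "h \<in> borel_measurable unit_interval_measure"
    "weak_deriv q \<in> borel_measurable unit_interval_measure"
    "weak_deriv (primitive h) \<in> borel_measurable unit_interval_measure"
    using assms weak_deriv_V primitive_in_V by (auto intro!: L2_borel_measurable)
  show "(\<lambda>x. weak_deriv (primitive h) x * weak_deriv q x) \<in> borel_measurable unit_interval_measure"
    "(\<lambda>x. h x * weak_deriv q x) \<in> borel_measurable unit_interval_measure" by measurable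
  show "AE x in unit_interval_measure. weak_deriv (primitive h) x * weak_deriv q x = h x * weak_deriv q x"
    using weak_deriv_primitive[OF assms(1)] by (auto elim: eventually_mono)
qed

lemma V_diff:
  assumes "r \<in> V" "p \<in> V"
  shows "(\<lambda>x. r x - p x) \<in> V"
    and "q \<in> V \<Longrightarrow> (LINT x|unit_interval_measure. weak_deriv (\<lambda>x. r x - p x) x * weak_deriv q x)
      = (LINT x|unit_interval_measure. weak_deriv r x * weak_deriv q x)
        - (LINT x|unit_interval_measure. weak_deriv p x * weak_deriv q x)"
proof -
  have eq: "(\<lambda>x. r x - p x) = primitive (\<lambda>x. weak_deriv r x - weak_deriv p x)"
    using assms by (simp add: primitive_diff_fun weak_deriv_V)
  have L: "(\<lambda>x. weak_deriv r x - weak_deriv p x) \<in> L2"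
    using assms by (intro L2_diff weak_deriv_V)
  show "(\<lambda>x. r x - p x) \<in> V" unfolding eq by (rule primitive_in_V[OF L])
  assume q: "q \<in> V"
  show "(LINT x|unit_interval_measure. weak_deriv (\<lambda>x. r x - p x) x * weak_deriv q x)
      = (LINT x|unit_interval_measure. weak_deriv r x * weak_deriv q x)
        - (LINT x|unit_interval_measure. weak_deriv p x * weak_deriv q x)"
    unfolding eq weak_deriv_integral_primitive[OF L q]
    using assms q by (simp add: left_diff_distrib L2_integrable_mult weak_deriv_V)
qed

text \<open>The two problems differ only in the set \<open>C\<close> of points that carry weights and loads: a finite
  stage of the development, or the whole microstructure.\<close>

definition weak_solution ::
    "real set \<Rightarrow> (real \<Rightarrow> real) \<Rightarrow> (real \<Rightarrow> real) \<Rightarrow> (real \<Rightarrow> real) \<Rightarrow> (real \<Rightarrow> real) \<Rightarrow> bool" where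
  "weak_solution C \<beta> F f p \<longleftrightarrow> (\<forall>q\<in>V.
     (LINT x|unit_interval_measure. weak_deriv p x * weak_deriv q x) + (\<Sum>\<^sub>\<infinity>b\<in>C. \<beta> b * p b * q b)
     = (LINT x|unit_interval_measure. F x * q x) + (\<Sum>\<^sub>\<infinity>b\<in>C. f b * q b))"

lemma ell1_mult_V: "c \<in> ell1 C \<Longrightarrow> u \<in> V \<Longrightarrow> (\<lambda>b. c b * u b) \<in> ell1 C"
  using ell1_mult_bounded(1) V_abs_le by metis

lemma summable_mult_V:
  assumes "c \<in> ell1 C" "q \<in> V"
  shows "(\<lambda>b. c b * q b) summable_on C"
  using assms by (intro ell1_summable ell1_mult_V)

lemma weak_solution_diff:
  assumes \<beta>: "\<beta> \<in> ell1 C" and "F \<in> L2" "f \<in> ell1 C" "p \<in> V" "weak_solution C \<beta> F f p"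
    and "G \<in> L2" "g \<in> ell1 C" "r \<in> V" "weak_solution C \<beta> G g r"
  shows "weak_solution C \<beta> (\<lambda>x. G x - F x) (\<lambda>b. g b - f b) (\<lambda>x. r x - p x)"
  unfolding weak_solution_def
proof
  fix q assume q: "q \<in> V"
  have "(\<Sum>\<^sub>\<infinity>b\<in>C. \<beta> b * (r b - p b) * q b) = (\<Sum>\<^sub>\<infinity>b\<in>C. \<beta> b * r b * q b - \<beta> b * p b * q b)"
    by (simp add: algebra_simps)
  also have "\<dots> = (\<Sum>\<^sub>\<infinity>b\<in>C. \<beta> b * r b * q b) - (\<Sum>\<^sub>\<infinity>b\<in>C. \<beta> b * p b * q b)"
    by (intro ell1_infsum_diff ell1_mult_V assms q)
  finally have s1: "(\<Sum>\<^sub>\<infinity>b\<in>C. \<beta> b * (r b - p b) * q b)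
      = (\<Sum>\<^sub>\<infinity>b\<in>C. \<beta> b * r b * q b) - (\<Sum>\<^sub>\<infinity>b\<in>C. \<beta> b * p b * q b)" .
  have "(\<Sum>\<^sub>\<infinity>b\<in>C. (g b - f b) * q b) = (\<Sum>\<^sub>\<infinity>b\<in>C. g b * q b - f b * q b)"
    by (simp add: algebra_simps)
  also have "\<dots> = (\<Sum>\<^sub>\<infinity>b\<in>C. g b * q b) - (\<Sum>\<^sub>\<infinity>b\<in>C. f b * q b)"
    by (intro ell1_infsum_diff ell1_mult_V assms q)
  finally have s2: "(\<Sum>\<^sub>\<infinity>b\<in>C. (g b - f b) * q b) = (\<Sum>\<^sub>\<infinity>b\<in>C. g b * q b) - (\<Sum>\<^sub>\<infinity>b\<in>C. f b * q b)" .
  have s3: "(LINT x|unit_interval_measure. (G x - F x) * q x)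
      = (LINT x|unit_interval_measure. G x * q x) - (LINT x|unit_interval_measure. F x * q x)"
    using assms q by (simp add: left_diff_distrib L2_integrable_mult V_in_L2)
  show "(LINT x|unit_interval_measure. weak_deriv (\<lambda>x. r x - p x) x * weak_deriv q x)
      + (\<Sum>\<^sub>\<infinity>b\<in>C. \<beta> b * (r b - p b) * q b)
      = (LINT x|unit_interval_measure. (G x - F x) * q x) + (\<Sum>\<^sub>\<infinity>b\<in>C. (g b - f b) * q b)"
    unfolding s1 s2 s3 V_diff(2)[OF \<open>r \<in> V\<close> \<open>p \<in> V\<close> q]
    using assms q unfolding weak_solution_def by fastforce
qed

text \<open>Test the equation with the solution itself. Since the weights are nonnegative, the left side is
  at least the square of the norm of \<open>p\<close> in \<open>V\<close>, whereas the right side is at most this norm times the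
  norm of the data. The constant does not depend on the weights, which is what allows them to be
  increased step by step below.\<close>

lemma energy_estimate:
  assumes nonneg: "\<And>b. b \<in> C \<Longrightarrow> \<beta> b \<ge> 0"
    and F: "F \<in> L2" and f: "f \<in> ell1 C" and p: "p \<in> V" and sol: "weak_solution C \<beta> F f p"
  shows "V_norm p \<le> L2_norm F + ell1_norm C f"
proof -
  have "(V_norm p)\<^sup>2 \<le> (V_norm p)\<^sup>2 + (\<Sum>\<^sub>\<infinity>b\<in>C. \<beta> b * p b * p b)"
    by (simp add: infsum_nonneg nonneg mult.assoc)
  also have "\<dots> = (LINT x|unit_interval_measure. F x * p x) + (\<Sum>\<^sub>\<infinity>b\<in>C. f b * p b)"
    using sol p by (simp add: V_norm_square weak_solution_def)
  also have "\<dots> \<le> L2_norm F * V_norm p + V_norm p * ell1_norm C f"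
  proof (rule add_mono)
    have "(LINT x|unit_interval_measure. F x * p x) \<le> L2_norm F * L2_norm p"
      using L2_Cauchy_Schwarz[OF F V_in_L2[OF p]] by simp
    also have "\<dots> \<le> L2_norm F * V_norm p"
      by (intro mult_left_mono L2_norm_le_V_norm p L2_norm_nonneg)
    finally show "(LINT x|unit_interval_measure. F x * p x) \<le> L2_norm F * V_norm p" .
    show "(\<Sum>\<^sub>\<infinity>b\<in>C. f b * p b) \<le> V_norm p * ell1_norm C f"
      using infsum_le_ell1_norm[OF ell1_mult_V[OF f p]]
        ell1_mult_bounded(2)[OF f, of p "V_norm p", OF V_abs_le[OF p]]
      by simp
  qed
  also have "\<dots> = V_norm p * (L2_norm F + ell1_norm C f)" by (simp add: algebra_simps)
  finally have "V_norm p * V_norm p \<le> V_norm p * (L2_norm F + ell1_norm C f)"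
    by (simp add: power2_eq_square)
  then show ?thesis
    using V_norm_nonneg[of p] L2_norm_nonneg[of F] ell1_norm_nonneg[of C f]
    by (cases "V_norm p = 0") auto
qed

text \<open>Uniqueness, continuous dependence and the contraction property in the existence proof all
  follow from this estimate.\<close>

lemma stability_estimate:
  assumes "\<beta> \<in> ell1 C" "\<And>b. b \<in> C \<Longrightarrow> \<beta> b \<ge> 0"
    and "F \<in> L2" "f \<in> ell1 C" "p \<in> V" "weak_solution C \<beta> F f p"
    and "G \<in> L2" "g \<in> ell1 C" "r \<in> V" "weak_solution C \<beta> G g r"
  shows "V_norm (\<lambda>x. r x - p x) \<le> L2_norm (\<lambda>x. G x - F x) + ell1_norm C (\<lambda>b. g b - f b)"
  by (rule energy_estimate[OF assms(2)])
    (intro L2_diff ell1_diff V_diff weak_solution_diff assms | assumption)+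

section \<open>Existence by continuation in the weight\<close>

definition solvable :: "real set \<Rightarrow> (real \<Rightarrow> real) \<Rightarrow> bool" where
  "solvable C \<beta> \<longleftrightarrow> (\<forall>F\<in>L2. \<forall>f\<in>ell1 C. \<exists>p\<in>V. weak_solution C \<beta> F f p)"

lemma infsum_eq_LINT_count_space:
  assumes "c \<in> ell1 C"
  shows "integrable (count_space C) c" "(\<Sum>\<^sub>\<infinity>b\<in>C. c b) = (LINT b|count_space C. c b)"
proof -
  have a: "Infinite_Set_Sum.abs_summable_on c C"
    using assms abs_summable_equivalent[of c C] by (simp add: ell1_def)
  then show "integrable (count_space C) c" by (simp add: Infinite_Set_Sum.abs_summable_on_def)
  show "(\<Sum>\<^sub>\<infinity>b\<in>C. c b) = (LINT b|count_space C. c b)"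
    using infsetsum_infsum[OF a] by (simp add: infsetsum_def)
qed

text \<open>Without weights the equation asks for the function that represents the functional of the data,
  and the tail functions of the data give its derivative explicitly.\<close>

lemma solvable_zero_weight:
  assumes "countable C" "C \<subseteq> {0..1}"
  shows "solvable C (\<lambda>b. 0)"
  unfolding solvable_def
proof (intro ballI)
  fix F f assume F: "F \<in> L2" and f: "f \<in> ell1 C"
  define g1 where "g1 = (\<lambda>y. LINT s|unit_interval_measure. indicator {y<..} s * F s)"
  define g2 where "g2 = (\<lambda>y. LINT b|count_space C. indicator {y<..} b * f b)"
  note F1 = Fubini_primitive[OF sigma_finite_unit_interval_measure _ id_measurable_unit_interval
      L2_integrable[OF F], folded g1_def]
  note F2 = Fubini_primitive[OF sigma_finite_measure_count_space_countable[OF assms(1)] _ _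
      infsum_eq_LINT_count_space(1)[OF f], folded g2_def]
  have g: "g1 \<in> L2" "g2 \<in> L2"
    using F1(1) F2(1) L2_const[of 0] assms(2) by (auto simp: greaterThanLessThan_subseteq_atLeastAtMost_iff)
  have "weak_solution C (\<lambda>b. 0) F f (primitive (\<lambda>y. g1 y + g2 y))"
    unfolding weak_solution_def
  proof
    fix q assume q: "q \<in> V"
    have wq: "weak_deriv q \<in> L2" "primitive (weak_deriv q) = q" using weak_deriv_V[OF q] by auto
    have "(LINT x|unit_interval_measure. weak_deriv (primitive (\<lambda>y. g1 y + g2 y)) x * weak_deriv q x)
        = (LINT x|unit_interval_measure. (g1 x + g2 x) * weak_deriv q x)"
      by (intro weak_deriv_integral_primitive L2_add g q)
    also have "\<dots> = (LINT x|unit_interval_measure. g1 x * weak_deriv q x)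
        + (LINT x|unit_interval_measure. g2 x * weak_deriv q x)"
      using g wq by (simp add: distrib_right L2_integrable_mult)
    also have "(LINT x|unit_interval_measure. g1 x * weak_deriv q x) = (LINT x|unit_interval_measure. F x * q x)"
      using F1(2)[OF _ wq(1)] wq(2) by (simp add: g1_def greaterThanLessThan_subseteq_atLeastAtMost_iff)
    also have "(LINT x|unit_interval_measure. g2 x * weak_deriv q x) = (\<Sum>\<^sub>\<infinity>b\<in>C. f b * q b)"
      using F2(2)[OF _ _ wq(1)] wq(2) assms(2) infsum_eq_LINT_count_space(2)[OF ell1_mult_V[OF f q]]
      by (simp add: g2_def)
    finally show "(LINT x|unit_interval_measure. weak_deriv (primitive (\<lambda>y. g1 y + g2 y)) x * weak_deriv q x)
        + (\<Sum>\<^sub>\<infinity>b\<in>C. 0 * primitive (\<lambda>y. g1 y + g2 y) b * q b)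
        = (LINT x|unit_interval_measure. F x * q x) + (\<Sum>\<^sub>\<infinity>b\<in>C. f b * q b)" by simp
  qed
  then show "\<exists>p\<in>V. weak_solution C (\<lambda>b. 0) F f p"
    using primitive_in_V[OF L2_add[OF g]] by blast
qed

text \<open>Move the additional term \<open>\<gamma> p\<close> to the right side: \<open>p\<close> is a solution for \<open>\<beta> + \<gamma>\<close> iff it is the solution for
  \<open>\<beta>\<close> with point loads \<open>f - \<gamma> p\<close>. By the stability estimate the map that sends \<open>P\<close> to the solution
  for \<open>\<beta>\<close> with loads \<open>f - \<gamma> P\<close> has supremum-norm Lipschitz constant at most the \<open>ell1\<close> norm of
  \<open>\<gamma>\<close>. All bounded continuous \<open>P\<close> are admitted, so the contraction lives on a complete
  space, while its fixed point lies in \<open>V\<close> because every value of the map does.\<close>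

lemma solvable_add_small_weight:
  assumes C: "C \<subseteq> {0..1}" and solv: "solvable C \<beta>"
    and \<beta>: "\<beta> \<in> ell1 C" "\<And>b. b \<in> C \<Longrightarrow> \<beta> b \<ge> 0"
    and \<gamma>: "\<gamma> \<in> ell1 C" and small: "ell1_norm C \<gamma> < 1"
  shows "solvable C (\<lambda>b. \<beta> b + \<gamma> b)"
  unfolding solvable_def
proof (intro ballI)
  fix F f assume F: "F \<in> L2" and f: "f \<in> ell1 C"
  from solv F have "\<forall>g\<in>ell1 C. \<exists>p. p \<in> V \<and> weak_solution C \<beta> F g p"
    unfolding solvable_def by blast
  then obtain S where S: "\<And>g. g \<in> ell1 C \<Longrightarrow> S g \<in> V \<and> weak_solution C \<beta> F g (S g)"
    by metis
  have S_lip: "\<bar>S g x - S h x\<bar> \<le> ell1_norm C (\<lambda>b. g b - h b)" if "g \<in> ell1 C" "h \<in> ell1 C" for g h x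
  proof -
    have "\<bar>S g x - S h x\<bar> \<le> V_norm (\<lambda>x. S g x - S h x)"
      using V_abs_le[OF V_diff(1)] S that by blast
    also have "\<dots> \<le> L2_norm (\<lambda>x. F x - F x) + ell1_norm C (\<lambda>b. g b - h b)"
      by (intro stability_estimate[OF \<beta>]) (use F S that in auto)
    finally show ?thesis by (simp add: L2_norm_def)
  qed
  define load where "load P = (\<lambda>b. f b - \<gamma> b * apply_bcontfun P b)" for P :: "real \<Rightarrow>\<^sub>C real"
  have bnd: "\<bar>apply_bcontfun P x\<bar> \<le> norm P" for P :: "real \<Rightarrow>\<^sub>C real" and x
    using norm_bounded[of P x] by simp
  have load: "load P \<in> ell1 C" for P
    unfolding load_def by (intro ell1_diff f ell1_mult_bounded(1)[OF \<gamma> bnd])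
  \<comment> \<open>Elements of \<open>V\<close> may jump at 1, where they are cut off to 0. Composing with the
    retraction onto \<open>[0,1]\<close> makes them continuous on the whole line.\<close>
  define cl :: "real \<Rightarrow> real" where "cl x = max 0 (min 1 x)" for x
  define T where "T P = Bcontfun (\<lambda>x. S (load P) (cl x))" for P
  have bc: "(\<lambda>x. S (load P) (cl x)) \<in> bcontfun" for P
  proof (rule bcontfun_normI)
    have "continuous_on {0..1} (S (load P))" using S[OF load[of P]] by (simp add: V_def)
    then show "continuous_on UNIV (\<lambda>x. S (load P) (cl x))"
      by (rule continuous_on_compose2) (auto simp: cl_def intro!: continuous_intros)
    show "norm (S (load P) (cl x)) \<le> V_norm (S (load P))" for x
      using V_abs_le S load by simp
  qed
  have T: "apply_bcontfun (T P) x = S (load P) (cl x)" for P x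
    unfolding T_def using bc by (simp add: Bcontfun_inverse)
  have "dist (T P) (T Q) \<le> ell1_norm C \<gamma> * dist P Q" for P Q
  proof (rule dist_bound)
    fix x
    have "dist (T P x) (T Q x) \<le> ell1_norm C (\<lambda>b. load P b - load Q b)"
      unfolding T dist_real_def by (intro S_lip load)
    also have "(\<lambda>b. load P b - load Q b) = (\<lambda>b. \<gamma> b * (Q b - P b))"
      by (simp add: load_def fun_eq_iff algebra_simps)
    also have "ell1_norm C (\<lambda>b. \<gamma> b * (Q b - P b)) \<le> dist P Q * ell1_norm C \<gamma>"
    proof (rule ell1_mult_bounded(2)[OF \<gamma>])
      show "\<bar>Q b - P b\<bar> \<le> dist P Q" for b
        using dist_bounded[of P b Q] by (simp add: dist_real_def abs_minus_commute)
    qed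
    finally show "dist (T P x) (T Q x) \<le> ell1_norm C \<gamma> * dist P Q" by (simp add: mult.commute)
  qed
  then obtain P where P: "T P = P"
    using banach_fix_type[OF ell1_norm_nonneg small, of T] by blast
  define p where "p = S (load P)"
  have p: "p \<in> V" "weak_solution C \<beta> F (load P) p" using S[OF load[of P]] by (auto simp: p_def)
  have Pp: "P b = p b" if "b \<in> C" for b
    using T[of P b] that C by (auto simp: P p_def cl_def max_def min_def)
  have "weak_solution C (\<lambda>b. \<beta> b + \<gamma> b) F f p"
    unfolding weak_solution_def
  proof
    fix q assume q: "q \<in> V"
    have "(\<Sum>\<^sub>\<infinity>b\<in>C. (\<beta> b + \<gamma> b) * p b * q b) = (\<Sum>\<^sub>\<infinity>b\<in>C. \<beta> b * p b * q b + \<gamma> b * p b * q b)"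
      by (simp add: algebra_simps)
    also have "\<dots> = (\<Sum>\<^sub>\<infinity>b\<in>C. \<beta> b * p b * q b) + (\<Sum>\<^sub>\<infinity>b\<in>C. \<gamma> b * p b * q b)"
      by (intro infsum_add summable_mult_V ell1_mult_V \<beta> \<gamma> p q)
    finally have s1: "(\<Sum>\<^sub>\<infinity>b\<in>C. (\<beta> b + \<gamma> b) * p b * q b)
        = (\<Sum>\<^sub>\<infinity>b\<in>C. \<beta> b * p b * q b) + (\<Sum>\<^sub>\<infinity>b\<in>C. \<gamma> b * p b * q b)" .
    have "(\<Sum>\<^sub>\<infinity>b\<in>C. load P b * q b) = (\<Sum>\<^sub>\<infinity>b\<in>C. f b * q b - \<gamma> b * p b * q b)"
      by (rule infsum_cong) (simp add: load_def Pp algebra_simps)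
    also have "\<dots> = (\<Sum>\<^sub>\<infinity>b\<in>C. f b * q b) - (\<Sum>\<^sub>\<infinity>b\<in>C. \<gamma> b * p b * q b)"
      by (intro ell1_infsum_diff ell1_mult_V f \<gamma> p q)
    finally have s2: "(\<Sum>\<^sub>\<infinity>b\<in>C. load P b * q b)
        = (\<Sum>\<^sub>\<infinity>b\<in>C. f b * q b) - (\<Sum>\<^sub>\<infinity>b\<in>C. \<gamma> b * p b * q b)" .
    have "(LINT x|unit_interval_measure. weak_deriv p x * weak_deriv q x)
        + (\<Sum>\<^sub>\<infinity>b\<in>C. \<beta> b * p b * q b)
        = (LINT x|unit_interval_measure. F x * q x) + (\<Sum>\<^sub>\<infinity>b\<in>C. load P b * q b)"
      using p(2) q by (simp add: weak_solution_def)
    then show "(LINT x|unit_interval_measure. weak_deriv p x * weak_deriv q x)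
        + (\<Sum>\<^sub>\<infinity>b\<in>C. (\<beta> b + \<gamma> b) * p b * q b)
        = (LINT x|unit_interval_measure. F x * q x) + (\<Sum>\<^sub>\<infinity>b\<in>C. f b * q b)"
      unfolding s1 s2 by simp
  qed
  with p(1) show "\<exists>p\<in>V. weak_solution C (\<lambda>b. \<beta> b + \<gamma> b) F f p" by blast
qed

text \<open>Reach \<open>\<beta>\<close> from 0 in finitely many equal steps, each small enough for the contraction.\<close>

lemma solvable_nonneg_weight:
  assumes C: "countable C" "C \<subseteq> {0..1}"
    and \<beta>: "\<beta> \<in> ell1 C" and nonneg: "\<And>b. b \<in> C \<Longrightarrow> \<beta> b \<ge> 0"
  shows "solvable C \<beta>"
proof -
  obtain N :: nat where N: "ell1_norm C \<beta> < real N" using reals_Archimedean2 by blast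
  then have "N > 0" using ell1_norm_nonneg[of C \<beta>] by (cases N) auto
  have "ell1_norm C (\<lambda>b. \<beta> b * (1 / N)) \<le> 1 / N * ell1_norm C \<beta>"
    by (rule ell1_mult_bounded(2)[OF \<beta>]) simp
  also have "\<dots> < 1" using N \<open>N > 0\<close> by simp
  finally have small: "ell1_norm C (\<lambda>b. 1 / N * \<beta> b) < 1" by (simp add: mult.commute)
  have "solvable C (\<lambda>b. real k / N * \<beta> b)" for k
  proof (induction k)
    case 0
    show ?case using solvable_zero_weight[OF C] by simp
  next
    case (Suc k)
    have "solvable C (\<lambda>b. real k / N * \<beta> b + 1 / N * \<beta> b)"
      by (rule solvable_add_small_weight[OF C(2) Suc ell1_scale[OF \<beta>] _ ell1_scale[OF \<beta>] small]) (simp add: nonneg)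
    then show ?case by (simp add: add_divide_distrib distrib_right add.commute)
  qed
  from this[of N] show ?thesis using \<open>N > 0\<close> by simp
qed

section \<open>Well-posedness\<close>

lemma well_posed_weak_solution:
  assumes B: "countable C" "C \<subseteq> B" "C \<subseteq> {0..1}"
    and \<beta>: "\<beta> \<in> ell1 C" "\<And>b. b \<in> C \<Longrightarrow> \<beta> b \<ge> 0"
  shows "well_posed B (weak_solution C \<beta>)"
  unfolding well_posed_def
proof (intro conjI ballI impI allI)
  fix F f assume F: "F \<in> L2" and fB: "f \<in> ell1 B"
  have f: "f \<in> ell1 C" using ell1_subset(1)[OF fB B(2)] .
  note stable = stability_estimate[OF \<beta>(1) _ F f]
  show "\<exists>!p. p \<in> V \<and> weak_solution C \<beta> F f p"
  proof (rule ex_ex1I)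
    show "\<exists>p. p \<in> V \<and> weak_solution C \<beta> F f p"
      using solvable_nonneg_weight[OF B(1,3) \<beta>] F f unfolding solvable_def by blast
    fix p r assume p: "p \<in> V \<and> weak_solution C \<beta> F f p" and r: "r \<in> V \<and> weak_solution C \<beta> F f r"
    have "V_norm (\<lambda>x. p x - r x) \<le> 0"
      using stable[of r F f p] \<beta>(2) p r F f by (simp add: L2_norm_def ell1_norm_def)
    moreover have "\<bar>p x - r x\<bar> \<le> V_norm (\<lambda>x. p x - r x)" for x
      by (rule V_abs_le[OF V_diff(1)]) (use p r in auto)
    ultimately have "\<bar>p x - r x\<bar> \<le> 0" for x by (rule order_trans[rotated])
    then show "p = r" by (simp add: fun_eq_iff)
  qed
  fix p and e :: real assume p: "p \<in> V" "weak_solution C \<beta> F f p" and e: "e > 0"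
  show "\<exists>d>0. \<forall>G\<in>L2. \<forall>g\<in>ell1 B. \<forall>r\<in>V. weak_solution C \<beta> G g r \<longrightarrow>
      L2_norm (\<lambda>x. G x - F x) + ell1_norm B (\<lambda>b. g b - f b) < d \<longrightarrow> V_norm (\<lambda>x. r x - p x) < e"
  proof (intro exI conjI ballI impI)
    fix G g r assume G: "G \<in> L2" and gB: "g \<in> ell1 B" and r: "r \<in> V" "weak_solution C \<beta> G g r"
      and lt: "L2_norm (\<lambda>x. G x - F x) + ell1_norm B (\<lambda>b. g b - f b) < e"
    have "V_norm (\<lambda>x. r x - p x) \<le> L2_norm (\<lambda>x. G x - F x) + ell1_norm C (\<lambda>b. g b - f b)"
      by (rule stable[OF _ p G ell1_subset(1)[OF gB B(2)] r]) (rule \<beta>(2))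
    also have "\<dots> \<le> L2_norm (\<lambda>x. G x - F x) + ell1_norm B (\<lambda>b. g b - f b)"
      using ell1_subset(2)[OF ell1_diff[OF gB fB] B(2)] by simp
    finally show "V_norm (\<lambda>x. r x - p x) < e" using lt by simp
  qed (rule e)
qed

section \<open>Summability of the storage coefficient\<close>

lemma card_development_le:
  assumes dev: "sigma_finite_development L Bn B"
  shows "card (Bn n) \<le> L ^ n * card (Bn 0)"
proof (induction n)
  case (Suc n)
  from dev obtain S :: "nat \<Rightarrow> real \<Rightarrow> real" where S: "\<And>n. n \<ge> 1 \<Longrightarrow> Bn n = (\<Union>i\<in>{1..L}. S i ` Bn (n - 1))"
    unfolding sigma_finite_development_def by blast
  have fin: "finite (Bn n)" using dev by (simp add: sigma_finite_development_def)
  have "card (Bn (Suc n)) \<le> (\<Sum>i\<in>{1..L}. card (S i ` Bn n))"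
    using S[of "Suc n"] card_UN_le[of "{1..L}" "\<lambda>i. S i ` Bn n"] by simp
  also have "\<dots> \<le> (\<Sum>i\<in>{1..L}. card (Bn n))" by (intro sum_mono card_image_le fin)
  also have "\<dots> \<le> L * (L ^ n * card (Bn 0))" using Suc by simp
  finally show ?case by (simp add: mult.assoc)
qed simp

text \<open>With \<open>r = 1/L - \<epsilon>\<close>, a point that first appears in stage \<open>n \<ge> 1\<close> has weight \<open>a r\<^sup>n\<close>. There are at
  most \<open>L\<^sup>n card (Bn 0)\<close> of them, so the weights are dominated by the geometric series with
  ratio \<open>r L < 1\<close>. The points of stage 0 have weight 0, as the series starts at 1.\<close>

lemma storage_coefficient_ell1:
  assumes dev: "sigma_finite_development L Bn B" and nonneg: "\<And>b. b \<in> B \<Longrightarrow> \<beta> b \<ge> 0"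
    and sc: "scales_consistently L Bn B \<beta>"
  shows "\<beta> \<in> ell1 B"
proof -
  from sc obtain a \<epsilon> where a: "a > 0" and \<epsilon>: "0 < \<epsilon>" "\<epsilon> < 1 / real L"
    and \<beta>: "\<And>b. b \<in> B \<Longrightarrow> \<beta> b = a * (\<Sum>\<^sub>\<infinity>n\<in>{1..}. (1 / real L - \<epsilon>) ^ n * indicator (Bn n - Bn (n - 1)) b)"
    unfolding scales_consistently_def by blast
  define r where "r = 1 / real L - \<epsilon>"
  define x where "x = r * real L"
  have L: "L \<ge> 2" and mono: "mono Bn" and fin: "\<And>n. finite (Bn n)" and sub: "\<And>n. Bn n \<subseteq> B"
    and un: "(\<Union>n. Bn n) = B"
    using dev by (auto simp: sigma_finite_development_def)
  have r: "r > 0" using \<epsilon> by (simp add: r_def)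
  have x: "0 \<le> x" "x < 1" using r L \<epsilon> by (auto simp: x_def r_def field_simps)
  have \<beta>0: "\<beta> b = 0" if "b \<in> Bn 0" for b
  proof -
    have "b \<in> Bn n" for n using that monoD[OF mono, of 0 n] by auto
    then show ?thesis using \<beta>[of b] sub that by (auto simp: indicator_def)
  qed
  have \<beta>Suc: "\<beta> b = a * r ^ Suc n" if b: "b \<in> Bn (Suc n) - Bn n" for b n
  proof -
    have "k = Suc n" if "b \<in> Bn k - Bn (k - 1)" for k
    proof (rule ccontr)
      assume "k \<noteq> Suc n"
      then consider "k \<le> n" | "Suc n \<le> k - 1" by linarith
      then show False
        using that b monoD[OF mono, of k n] monoD[OF mono, of "Suc n" "k - 1"] by cases auto
    qed
    then have ind: "indicator (Bn k - Bn (k - 1)) b = (if k = Suc n then 1 else 0 :: real)" for k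
      using b by (auto simp: indicator_def)
    have "(\<Sum>\<^sub>\<infinity>k\<in>{1..}. r ^ k * indicator (Bn k - Bn (k - 1)) b) = (\<Sum>\<^sub>\<infinity>k\<in>{Suc n}. r ^ k)"
      unfolding ind by (rule infsum_cong_neutral) auto
    then show ?thesis using \<beta>[of b] b sub by (auto simp: r_def)
  qed
  have bound: "sum \<beta> (Bn n) \<le> a * real (card (Bn 0)) * (\<Sum>k\<le>n. x ^ k)" for n
  proof (induction n)
    case 0
    then show ?case using a \<beta>0 by simp
  next
    case (Suc n)
    have "sum \<beta> (Bn (Suc n)) = sum \<beta> (Bn (Suc n) - Bn n) + sum \<beta> (Bn n)"
      by (rule sum.subset_diff) (use fin monoD[OF mono, of n "Suc n"] in auto)
    also have "sum \<beta> (Bn (Suc n) - Bn n) = real (card (Bn (Suc n) - Bn n)) * (a * r ^ Suc n)"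
      using \<beta>Suc by simp
    also have "\<dots> \<le> real (L ^ Suc n * card (Bn 0)) * (a * r ^ Suc n)"
    proof (rule mult_right_mono)
      have "card (Bn (Suc n) - Bn n) \<le> card (Bn (Suc n))" by (intro card_mono fin) auto
      also note card_development_le[OF dev]
      finally show "real (card (Bn (Suc n) - Bn n)) \<le> real (L ^ Suc n * card (Bn 0))"
        using of_nat_mono by blast
    qed (use a r in simp)
    also have "\<dots> = a * real (card (Bn 0)) * x ^ Suc n"
      by (simp add: x_def power_mult_distrib)
    finally show ?case using Suc by (simp add: distrib_left)
  qed
  have "\<beta> summable_on B"
  proof (rule nonneg_bdd_above_summable_on)
    show "bdd_above (sum \<beta> ` {X. X \<subseteq> B \<and> finite X})"
    proof (rule bdd_aboveI2)
      fix X assume "X \<in> {X. X \<subseteq> B \<and> finite X}"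
      then have "finite X" "X \<subseteq> (\<Union>n. Bn n)" using un by auto
      then have "\<exists>n. X \<subseteq> Bn n"
      proof (induction X)
        case (insert b X)
        then obtain m n where "X \<subseteq> Bn m" "b \<in> Bn n" by auto
        then have "insert b X \<subseteq> Bn (max m n)"
          using monoD[OF mono, of m "max m n"] monoD[OF mono, of n "max m n"] by auto
        then show ?case ..
      qed simp
      then obtain n where "X \<subseteq> Bn n" ..
      then have "sum \<beta> X \<le> sum \<beta> (Bn n)"
        using fin subsetD[OF sub] nonneg by (intro sum_mono2) auto
      also have "\<dots> \<le> a * real (card (Bn 0)) * (\<Sum>k\<le>n. x ^ k)" by (rule bound)
      also have "\<dots> \<le> a * real (card (Bn 0)) * (\<Sum>k. x ^ k)"
        using a x by (intro mult_left_mono sum_le_suminf) (auto intro: summable_geometric)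
      finally show "sum \<beta> X \<le> a * real (card (Bn 0)) * (\<Sum>k. x ^ k)" .
    qed
  qed (rule nonneg)
  then show ?thesis
    unfolding ell1_def using nonneg by (simp cong: summable_on_cong)
qed

section \<open>The two problems\<close>

theorem theorem11:
  fixes B :: "real set" and Bn :: "nat \<Rightarrow> real set" and L :: nat and \<beta> :: "real \<Rightarrow> real"
  assumes "fractal_microstructure B"
    and "sigma_finite_development L Bn B"
    and "\<forall>b\<in>B. \<beta> b \<ge> 0"
    and "scales_consistently L Bn B \<beta>"
  shows "(\<forall>n\<ge>1. well_posed B (\<lambda>F f p. \<forall>q\<in>V.
            (LINT x|unit_interval_measure. weak_deriv p x * weak_deriv q x)
              + (\<Sum>b\<in>Bn n. \<beta> b * p b * q b)
            = (LINT x|unit_interval_measure. F x * q x) + (\<Sum>b\<in>Bn n. f b * q b)))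
       \<and> well_posed B (\<lambda>F f p. \<forall>q\<in>V.
            (LINT x|unit_interval_measure. weak_deriv p x * weak_deriv q x)
              + (\<Sum>\<^sub>\<infinity>b\<in>B. \<beta> b * p b * q b)
            = (LINT x|unit_interval_measure. F x * q x) + (\<Sum>\<^sub>\<infinity>b\<in>B. f b * q b))"
proof (intro conjI allI impI)
  have B: "countable B" "B \<subseteq> {0..1}" using assms(1) by (auto simp: fractal_microstructure_def)
  have \<beta>: "\<beta> \<in> ell1 B" using storage_coefficient_ell1 assms by blast
  have "well_posed B (weak_solution B \<beta>)"
    using well_posed_weak_solution[OF B(1) _ B(2) \<beta>] assms(3) by blast
  then show "well_posed B (\<lambda>F f p. \<forall>q\<in>V.
            (LINT x|unit_interval_measure. weak_deriv p x * weak_deriv q x)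
              + (\<Sum>\<^sub>\<infinity>b\<in>B. \<beta> b * p b * q b)
            = (LINT x|unit_interval_measure. F x * q x) + (\<Sum>\<^sub>\<infinity>b\<in>B. f b * q b))"
    unfolding weak_solution_def[abs_def] .
  fix n :: nat
  have Bn: "finite (Bn n)" "Bn n \<subseteq> B"
    using assms(2) by (auto simp: sigma_finite_development_def)
  have "well_posed B (weak_solution (Bn n) \<beta>)"
    by (rule well_posed_weak_solution)
      (use Bn B \<beta> assms(3) in \<open>auto intro: countable_finite ell1_subset(1)\<close>)
  then show "well_posed B (\<lambda>F f p. \<forall>q\<in>V.
            (LINT x|unit_interval_measure. weak_deriv p x * weak_deriv q x)
              + (\<Sum>b\<in>Bn n. \<beta> b * p b * q b)
            = (LINT x|unit_interval_measure. F x * q x) + (\<Sum>b\<in>Bn n. f b * q b))"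
    unfolding weak_solution_def[abs_def] infsum_finite[OF Bn(1)] .
qed

end
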